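(* Let $t_1,\dots,t_m$ be algebraic numbers in $\mathbb{C}$, and let $p=(p_j)_{j=1}^m$ be a probability vector. Set $\nu=\sum_{j=1}^m p_j\delta_{t_j}$. Then for any $h\in(0,H(p))$, there is a positive number $M$ depending on $h$, $t_1,\dots,t_m$ and $p_1,\dots,p_m$, such that $h_{\eta,\nu}\ge h$ for every algebraic number $\eta\in\mathbb{C}$ with $0<|\eta|<1$ and $M(\eta)\ge M$.
   Context: $H(p)=-\sum_{j=1}^m p_j\log p_j$ (with $0\log0=0$). For $\eta\in\mathbb{C}$ with $0<|\eta|<1$, the Garsia entropy is $h_{\eta,\nu}=\lim_{n\to\infty}\frac1n H\big(\sum_{j=0}^{n-1}\xi_j\eta^j\big)$, where $(\xi_j)_{j\ge0}$ are independent random variables with common law $\nu$ and $H(X)=-\sum_x\mathbb{P}\{X=x\}\log\mathbb{P}\{X=x\}$ is the Shannon entropy of a discrete random variable; the limit always exists by subadditivity. For an algebraic number $\beta$ with minimal polynomial $f(X)=a_n\prod_{i=1}^n(X-\beta_i)\in\mathbb{Z}[X]$ with coprime integer coefficients, the Mahler measure is $M(\beta)=|a_n|\prod_{i=1}^n\max\{1,|\beta_i|\}$.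
   Formalization: The numbers t_1,…,t_m are assumed pairwise distinct; without this the claim fails, e.g. for t_1=t_2 and p=(1/2,1/2), where ν is a point mass and h_{η,ν}=0 although H(p)=log 2. *)

theory Defs
  imports
    "HOL-Probability.Probability"
    "Berlekamp_Zassenhaus.Mahler_Measure"
begin

definition vector_entropy :: "nat \<Rightarrow> (nat \<Rightarrow> real) \<Rightarrow> real" where
  "vector_entropy m p = - (\<Sum>j = 1..m. p j * ln (p j))"

text \<open>
  The Shannon entropy of a discrete random variable, as a function of its law. Logarithms are
  natural, and \<open>ln 0 = 0\<close> implements the convention \<open>0 log 0 = 0\<close>. The value is only meaningful
  when the sum converges; below it is applied to finitely supported laws only.
\<close>

definition shannon_entropy :: "'a pmf \<Rightarrow> real" where
  "shannon_entropy X = - (\<Sum>\<^sub>\<infinity>x\<in>UNIV. pmf X x * ln (pmf X x))"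

text \<open>
  The measure \<open>\<nu> = \<Sum>j=1..m. p j \<delta>\<^bsub>t j\<^esub>\<close>. The library constant \<open>pmf_of_list\<close> adds up the weights of
  repeated atoms; it is a junk value unless \<open>p\<close> is a probability vector.
\<close>

definition atomic_law :: "nat \<Rightarrow> (nat \<Rightarrow> real) \<Rightarrow> (nat \<Rightarrow> complex) \<Rightarrow> complex pmf" where
  "atomic_law m p t = pmf_of_list (map (\<lambda>j. (t j, p j)) [1..<Suc m])"

text \<open>
  The law of \<open>\<Sum>j<n. \<xi>\<^sub>j \<eta>\<^sup>j\<close>, where \<open>\<xi>\<^sub>0, \<dots>, \<xi>\<^bsub>n-1\<^esub>\<close> are independent with common law \<open>\<nu>\<close>: their joint
  law is the product \<open>Pi_pmf\<close> (whose second argument is only a default value outside \<open>{..<n}\<close>).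
\<close>

definition partial_sum_law :: "complex \<Rightarrow> complex pmf \<Rightarrow> nat \<Rightarrow> complex pmf" where
  "partial_sum_law \<eta> \<nu> n =
     map_pmf (\<lambda>\<xi>. \<Sum>j<n. \<xi> j * \<eta> ^ j) (Pi_pmf {..<n} 0 (\<lambda>_. \<nu>))"

definition garsia_entropy :: "complex \<Rightarrow> complex pmf \<Rightarrow> real" where
  "garsia_entropy \<eta> \<nu> = lim (\<lambda>n. shannon_entropy (partial_sum_law \<eta> \<nu> n) / real n)"

text \<open>
  The minimal polynomial of \<open>\<beta>\<close>, scaled to have coprime integer coefficients. This determines it up
  to sign only; a positive leading coefficient makes it unique, and the sign does not affect the
  Mahler measure. Meaningful for algebraic \<open>\<beta>\<close> only.
\<close>

definition is_int_minpoly :: "complex \<Rightarrow> int poly \<Rightarrow> bool" where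
  "is_int_minpoly \<beta> f \<longleftrightarrow>
     content f = 1 \<and> lead_coeff f > 0 \<and> poly (map_poly of_int f) \<beta> = 0 \<and>
     (\<forall>g. g \<noteq> 0 \<and> poly (map_poly of_int g) \<beta> = 0 \<longrightarrow> degree f \<le> degree g)"

definition int_minpoly :: "complex \<Rightarrow> int poly" where
  "int_minpoly \<beta> = (THE f. is_int_minpoly \<beta> f)"

text \<open>
  The library constant \<open>mahler_measure\<close> is the Mahler measure of an integer polynomial,
  \<open>\<bar>a\<^sub>n\<bar> \<Prod>i. max 1 \<bar>\<beta>\<^sub>i\<bar>\<close> over its complex roots with multiplicity.
\<close>

definition algebraic_mahler_measure :: "complex \<Rightarrow> real" where
  "algebraic_mahler_measure \<beta> = mahler_measure (int_minpoly \<beta>)"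

end

(* For the partial sums S_n = \<xi>_0 + \<eta> S_{n-1} one has H(S_n) = H(p) + H(S_{n-1}) - H(\<xi>_0 | S_n), so it
   suffices to recover \<xi>_0 from S_n with small error probability, uniformly in n.

   Let f be the primitive minimal polynomial of \<eta>. Then M(\<eta>) = |f(0)| \<Prod> 1/|\<beta>|, the product being
   over the roots \<beta> of f in the open unit disc.

   If |f(0)| is large, S_n determines \<xi>_0: a relation \<Sum> d_j \<eta>^j = 0 between digit differences, multiplied
   by a suitable e with e d_0 a nonzero integer N, has coefficients in an order, and taking a determinant
   over this order yields an integer polynomial divisible by f whose constant coefficient is a power of N.

   Otherwise \<Prod> 1/|\<beta>| is large. Each \<beta> comes from an embedding of \<rat>(\<eta>, t_1, ..., t_m), and by the
   pigeonhole principle \<Prod> 1/|\<beta>| is still large over a set G of roots whose embeddings agree on the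
   t_j. A linear combination of the conjugates of S_n over G has the form b s(\<xi>_0) + \<Sum>_{j>0} v_j s(\<xi>_j),
   where b, v_1, v_2, ... come from the Taylor coefficients of the Blaschke product of G. As the latter has norm
   one in the Hardy space, \<Sum> |v_j|^2 \<le> 1, while |b| is about \<Prod>_G 1/|\<beta>|. By Chebyshev's inequality
   this combination reveals s(\<xi>_0), and Fano's inequality bounds the conditional entropy. *)

theory Submission
  imports Defs "Jordan_Normal_Form.Char_Poly"
begin

section \<open>Shannon entropy\<close>

lemma shannon_entropy_eq_sum:
  assumes "finite (set_pmf X)"
  shows "shannon_entropy X = (\<Sum>x\<in>set_pmf X. pmf X x * - ln (pmf X x))"
proof -
  have "(\<Sum>\<^sub>\<infinity>x\<in>UNIV. pmf X x * ln (pmf X x)) = (\<Sum>\<^sub>\<infinity>x\<in>set_pmf X. pmf X x * ln (pmf X x))"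
    by (rule infsum_cong_neutral) (auto simp: set_pmf_eq)
  then show ?thesis
    using assms by (simp add: shannon_entropy_def sum_negf)
qed

lemma expectation_finite_support:
  fixes g :: "'a \<Rightarrow> 'b::{banach, second_countable_topology}"
  assumes "finite (set_pmf X)"
  shows "measure_pmf.expectation X g = (\<Sum>x\<in>set_pmf X. pmf X x *\<^sub>R g x)"
  using assms by (intro integral_measure_pmf) auto

text \<open>The entropy of an image law is the expectation of \<open>- ln\<close> of its mass
  function, pulled back along \<open>f\<close>. Keeping the sum over the support of \<open>X\<close>
  makes it comparable with the entropy of \<open>X\<close> term by term.\<close>

lemma shannon_entropy_map_pmf:
  assumes "finite (set_pmf X)"
  shows "shannon_entropy (map_pmf f X) =
           (\<Sum>x\<in>set_pmf X. pmf X x * - ln (pmf (map_pmf f X) (f x)))"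
proof -
  have "shannon_entropy (map_pmf f X) =
          measure_pmf.expectation (map_pmf f X) (\<lambda>y. - ln (pmf (map_pmf f X) y))"
    using assms by (subst shannon_entropy_eq_sum expectation_finite_support; simp)+
  also have "\<dots> = measure_pmf.expectation X (\<lambda>x. - ln (pmf (map_pmf f X) (f x)))"
    by simp
  finally show ?thesis
    using assms by (simp add: expectation_finite_support sum_negf)
qed

lemma pmf_le_pmf_map: "pmf X x \<le> pmf (map_pmf f X) (f x)"
  by (simp add: pmf_map flip: pmf.rep_eq)
     (metis measure_pmf.finite_measure_mono measure_pmf_single sets_measure_pmf singletonD
        subsetI UNIV_I vimage_singleton_eq)

lemma shannon_entropy_map_pmf_le:
  assumes "finite (set_pmf X)"
  shows "shannon_entropy (map_pmf f X) \<le> shannon_entropy X"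
  unfolding shannon_entropy_map_pmf[OF assms] shannon_entropy_eq_sum[OF assms]
  by (intro sum_mono mult_left_mono) (auto simp: pmf_positive pmf_le_pmf_map)

lemma shannon_entropy_map_pmf_inj_on:
  assumes "finite (set_pmf X)" "inj_on f (set_pmf X)"
  shows "shannon_entropy (map_pmf f X) = shannon_entropy X"
  unfolding shannon_entropy_map_pmf[OF assms(1)] shannon_entropy_eq_sum[OF assms(1)]
  by (intro sum.cong) (auto simp: pmf_map_inj[OF assms(2)])

lemma shannon_entropy_nonneg:
  assumes "finite (set_pmf X)"
  shows "shannon_entropy X \<ge> 0"
  unfolding shannon_entropy_eq_sum[OF assms]
  by (intro sum_nonneg mult_nonneg_nonneg) (auto simp: pmf_le_1 pmf_positive)

lemma shannon_entropy_pair_pmf: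
  assumes "finite (set_pmf X)" "finite (set_pmf Y)"
  shows "shannon_entropy (pair_pmf X Y) = shannon_entropy X + shannon_entropy Y"
proof -
  let ?A = "set_pmf X" and ?B = "set_pmf Y"
  have "shannon_entropy (pair_pmf X Y) =
          (\<Sum>(x, y)\<in>?A \<times> ?B. pmf X x * pmf Y y * - ln (pmf X x * pmf Y y))"
    using assms by (subst shannon_entropy_eq_sum) (auto simp: pmf_pair intro!: sum.cong)
  also have "\<dots> = (\<Sum>x\<in>?A. \<Sum>y\<in>?B. pmf X x * pmf Y y * - ln (pmf X x * pmf Y y))"
    by (simp add: sum.cartesian_product)
  also have "\<dots> = (\<Sum>x\<in>?A. \<Sum>y\<in>?B. pmf Y y * (pmf X x * - ln (pmf X x)) +
                                   pmf X x * (pmf Y y * - ln (pmf Y y)))"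
    by (intro sum.cong refl) (auto simp: ln_mult pmf_positive algebra_simps)
  also have "\<dots> = (\<Sum>x\<in>?A. pmf X x * - ln (pmf X x)) * (\<Sum>y\<in>?B. pmf Y y) +
                  (\<Sum>x\<in>?A. pmf X x) * (\<Sum>y\<in>?B. pmf Y y * - ln (pmf Y y))"
    by (simp only: sum.distrib sum_product) (simp add: mult_ac)
  also have "\<dots> = shannon_entropy X + shannon_entropy Y"
    using assms by (simp add: sum_pmf_eq_1 shannon_entropy_eq_sum)
  finally show ?thesis .
qed

text \<open>This is \<open>ln x \<le> x - 1\<close> at \<open>x = b / a\<close>. Summed over atoms
  it takes the place of Jensen's inequality.\<close>

lemma mult_ln_divide_le:
  fixes a b :: real
  assumes "a > 0" "b > 0"
  shows "a * ln (b / a) \<le> b - a"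
proof -
  have "a * ln (b / a) \<le> a * (b / a - 1)"
    using assms by (intro mult_left_mono ln_le_minus_one) auto
  then show ?thesis
    using assms by (simp add: algebra_simps)
qed

text \<open>A form of Fano's inequality in which the free parameter \<open>c\<close> avoids optimising the bound.\<close>

lemma shannon_entropy_fano:
  fixes Z :: "('a \<times> 'b) pmf" and c :: real
  assumes fin: "finite (set_pmf Z)" and det: "inj_on snd (set_pmf Z \<inter> D)" and c: "0 < c"
  defines "\<kappa> \<equiv> measure_pmf.prob Z (- D)"
  shows "shannon_entropy Z \<le> shannon_entropy (map_pmf snd Z) +
           \<kappa> + c * card (fst ` set_pmf Z) + \<kappa> * - ln c"
proof -
  let ?A = "set_pmf Z"
  define q where "q = pmf (map_pmf snd Z)"
  have q0: "q (snd z) > 0" if "z \<in> ?A" for z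
    using that by (auto simp: q_def intro!: pmf_positive)
  have Z0: "pmf Z z > 0" if "z \<in> ?A" for z
    using that by (simp add: pmf_positive)
  have q_nonneg: "q y \<ge> 0" for y by (simp add: q_def)
  have q_le: "sum q B \<le> 1" if "finite B" for B
    unfolding q_def using that by (simp add: measure_measure_pmf_finite[symmetric])
  have kappa: "\<kappa> = (\<Sum>z\<in>?A - D. pmf Z z)"
  proof -
    have "\<kappa> = measure_pmf.prob Z (?A - D)"
      unfolding \<kappa>_def by (rule measure_pmf.finite_measure_eq_AE) (auto simp: AE_measure_pmf_iff)
    then show ?thesis using fin by (simp add: measure_measure_pmf_finite)
  qed
  have total: "(\<Sum>z\<in>?A \<inter> D. pmf Z z) = 1 - \<kappa>"
  proof -
    have "(\<Sum>z\<in>?A. pmf Z z) = (\<Sum>z\<in>?A \<inter> D. pmf Z z) + (\<Sum>z\<in>?A - D. pmf Z z)"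
      using fin by (rule sum.Int_Diff)
    then show ?thesis using fin by (simp add: sum_pmf_eq_1 kappa)
  qed
  \<comment> \<open>The right-hand side is the conditional entropy of the first component given the
    second.\<close>
  have "shannon_entropy Z - shannon_entropy (map_pmf snd Z) =
          (\<Sum>z\<in>?A. pmf Z z * ln (q (snd z) / pmf Z z))"
    unfolding shannon_entropy_eq_sum[OF fin] shannon_entropy_map_pmf[OF fin] q_def[symmetric]
      sum_subtractf[symmetric]
    by (intro sum.cong) (auto simp: ln_div q0 Z0 less_imp_le algebra_simps dest: q0 Z0)
  also have "\<dots> = (\<Sum>z\<in>?A \<inter> D. pmf Z z * ln (q (snd z) / pmf Z z)) +
                  (\<Sum>z\<in>?A - D. pmf Z z * ln (q (snd z) / pmf Z z))"
    using fin by (rule sum.Int_Diff)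
  \<comment> \<open>On \<open>D\<close> the second component determines the pair, so each value of
    \<open>q\<close> is counted once and the total is at most 1.\<close>
  also have "(\<Sum>z\<in>?A \<inter> D. pmf Z z * ln (q (snd z) / pmf Z z)) \<le>
               (\<Sum>z\<in>?A \<inter> D. q (snd z) - pmf Z z)"
    by (intro sum_mono mult_ln_divide_le) (auto intro: q0 Z0)
  also have "\<dots> = sum q (snd ` (?A \<inter> D)) - (1 - \<kappa>)"
    by (simp add: sum_subtractf total sum.reindex[OF det])
  also have "\<dots> \<le> \<kappa>"
    using q_le[of "snd ` (?A \<inter> D)"] fin by simp
  also have "(\<Sum>z\<in>?A - D. pmf Z z * ln (q (snd z) / pmf Z z)) \<le>
               (\<Sum>z\<in>?A - D. c * q (snd z) + pmf Z z * - ln c)"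
  proof (rule sum_mono)
    fix z assume z: "z \<in> ?A - D"
    then have pos: "q (snd z) > 0" "pmf Z z > 0" by (auto intro: q0 Z0)
    \<comment> \<open>Off \<open>D\<close> the weight \<open>q\<close> is scaled by \<open>c\<close>
      before the bound is applied: its total then costs only a factor \<open>c\<close>, while the
      exceptional mass pays \<open>- ln c\<close>.\<close>
    have "ln (q (snd z) / pmf Z z) = ln (c * q (snd z) / pmf Z z) - ln c"
      using pos c by (simp add: ln_div ln_mult)
    then have "pmf Z z * ln (q (snd z) / pmf Z z) =
                 pmf Z z * ln (c * q (snd z) / pmf Z z) + pmf Z z * - ln c"
      by (simp only: diff_conv_add_uminus distrib_left)
    also have "pmf Z z * ln (c * q (snd z) / pmf Z z) \<le> c * q (snd z) - pmf Z z"
      using pos c by (intro mult_ln_divide_le) auto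
    finally show "pmf Z z * ln (q (snd z) / pmf Z z) \<le> c * q (snd z) + pmf Z z * - ln c"
      using pos by simp
  qed
  also have "\<dots> = c * (\<Sum>z\<in>?A - D. q (snd z)) + \<kappa> * - ln c"
    by (simp only: sum.distrib kappa sum_distrib_left sum_distrib_right)
  \<comment> \<open>In the product of the two projections each \<open>q y\<close> occurs once per
    first component, whence the cardinality.\<close>
  also have "(\<Sum>z\<in>?A - D. q (snd z)) \<le> (\<Sum>z\<in>fst ` ?A \<times> snd ` ?A. q (snd z))"
    using fin by (intro sum_mono2) (auto simp: q_nonneg intro: rev_image_eqI)
  also have "\<dots> = card (fst ` ?A) * sum q (snd ` ?A)"
    using sum.cartesian_product[of "\<lambda>x y. q y" "snd ` ?A" "fst ` ?A"]
    by (simp add: case_prod_unfold)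
  also have "\<dots> \<le> real (card (fst ` ?A)) * 1"
    using fin by (intro mult_left_mono q_le) auto
  finally show ?thesis using c by (simp add: algebra_simps)
qed

section \<open>Laws of partial sums and Garsia entropy\<close>

lemma partial_sum_law_0: "partial_sum_law \<eta> \<nu> 0 = return_pmf 0"
  by (simp add: partial_sum_law_def)

text \<open>Digit 0 is split off, rather than the last one, because it is the digit to be recovered;
  the other coordinates are shifted down by one.\<close>

lemma Pi_pmf_lessThan_Suc:
  "Pi_pmf {..<Suc n} d (\<lambda>_. \<nu>) = map_pmf (\<lambda>(x, \<xi>). case_nat x \<xi>) (pair_pmf \<nu> (Pi_pmf {..<n} d (\<lambda>_. \<nu>)))"
proof -
  have set_eq: "{..<Suc n} = insert 0 {Suc 0..<Suc n}" by auto
  have shift: "Pi_pmf {Suc 0..<Suc n} d (\<lambda>_. \<nu>) =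
      map_pmf (\<lambda>\<xi> i. if i = 0 then d else \<xi> (i - 1)) (Pi_pmf {..<n} d (\<lambda>_. \<nu>))"
  proof -
    \<comment> \<open>The value \<open>n\<close> at \<open>0\<close> lies outside
      \<open>{..<n}\<close>, so that the composite takes the default \<open>d\<close> there.\<close>
    let ?h = "\<lambda>i. if i = 0 then n else i - 1"
    have "Pi_pmf {Suc 0..<Suc n} d (\<lambda>_. \<nu>) = map_pmf (\<lambda>\<xi>. \<xi> \<circ> ?h) (Pi_pmf {..<n} d (\<lambda>_. \<nu>))"
      by (rule Pi_pmf_bij_betw) (auto intro!: bij_betwI[of _ _ _ Suc])
    also have "\<dots> = map_pmf (\<lambda>\<xi> i. if i = 0 then d else \<xi> (i - 1)) (Pi_pmf {..<n} d (\<lambda>_. \<nu>))"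
      using set_Pi_pmf_subset[of "{..<n}" d "\<lambda>_. \<nu>"]
      by (intro map_pmf_cong refl) (auto simp: fun_eq_iff)
    finally show ?thesis .
  qed
  show ?thesis
    unfolding set_eq
    apply (subst Pi_pmf_insert) apply simp apply simp
    unfolding shift pair_map_pmf2 map_pmf_comp
    by (intro map_pmf_cong refl) (auto simp: fun_eq_iff split: nat.splits)
qed

lemma partial_sum_law_Suc:
  "partial_sum_law \<eta> \<nu> (Suc n) =
     map_pmf (\<lambda>(x, y). x + \<eta> * y) (pair_pmf \<nu> (partial_sum_law \<eta> \<nu> n))"
  unfolding partial_sum_law_def Pi_pmf_lessThan_Suc pair_map_pmf2 map_pmf_comp
  by (intro map_pmf_cong refl)
     (auto simp: sum.lessThan_Suc_shift sum_distrib_left mult_ac simp del: sum.lessThan_Suc)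

lemma finite_set_partial_sum_law:
  assumes "finite (set_pmf \<nu>)"
  shows "finite (set_pmf (partial_sum_law \<eta> \<nu> n))"
  using assms by (induction n) (auto simp: partial_sum_law_0 partial_sum_law_Suc)

lemma partial_sum_law_add:
  "partial_sum_law \<eta> \<nu> (m + n) =
     map_pmf (\<lambda>(x, y). x + \<eta> ^ m * y) (pair_pmf (partial_sum_law \<eta> \<nu> m) (partial_sum_law \<eta> \<nu> n))"
proof (induction m)
  case 0
  then show ?case
    by (simp add: partial_sum_law_0 pair_return_pmf1 map_pmf_comp)
next
  case (Suc m)
  show ?case
    unfolding add_Suc partial_sum_law_Suc Suc.IH
    by (simp add: pair_pmf_def map_pmf_def bind_assoc_pmf bind_return_pmf algebra_simps)
qed

lemma shannon_entropy_partial_sum_law_add_le: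
  assumes "finite (set_pmf \<nu>)"
  shows "shannon_entropy (partial_sum_law \<eta> \<nu> (m + n)) \<le>
           shannon_entropy (partial_sum_law \<eta> \<nu> m) + shannon_entropy (partial_sum_law \<eta> \<nu> n)"
  unfolding partial_sum_law_add
  using shannon_entropy_map_pmf_le[of "pair_pmf (partial_sum_law \<eta> \<nu> m) (partial_sum_law \<eta> \<nu> n)"]
  by (simp add: shannon_entropy_pair_pmf finite_set_partial_sum_law assms)

text \<open>Fekete's lemma. The limit is the infimum \<open>L\<close> of the quotients, which
  nonnegativity bounds below.\<close>

lemma fekete_convergent:
  fixes a :: "nat \<Rightarrow> real"
  assumes sub: "\<And>m n. a (m + n) \<le> a m + a n" and nonneg: "\<And>n. a n \<ge> 0"
  shows "convergent (\<lambda>n. a n / real n)"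
proof -
  define L where "L = (INF n\<in>{1..}. a n / real n)"
  have bdd: "bdd_below ((\<lambda>n. a n / real n) ` {1..})"
    by (rule bdd_belowI[of _ 0]) (auto simp: nonneg)
  have mult: "a (q * k + r) \<le> real q * a k + a r" for q k r
  proof (induction q)
    case (Suc q)
    have "a (Suc q * k + r) \<le> a k + a (q * k + r)"
      using sub[of k "q * k + r"] by (simp add: add.assoc)
    with Suc show ?case by (simp add: algebra_simps)
  qed simp
  have "(\<lambda>n. a n / real n) \<longlonglongrightarrow> L"
  proof (rule LIMSEQ_I)
    fix e :: real assume e: "e > 0"
    \<comment> \<open>An index \<open>k\<close> whose quotient is close to \<open>L\<close> controls
      all large \<open>n\<close> through division with remainder; \<open>C\<close> bounds the
      contribution of the remainders.\<close>
    have "L < L + e / 2" using e by simp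
    then obtain k where k: "k \<ge> 1" "a k / real k < L + e / 2"
      unfolding L_def using bdd by (subst (asm) cINF_less_iff) auto
    define C where "C = Max (a ` {..<k})"
    have C: "a r \<le> C" if "r < k" for r
      unfolding C_def using that by (intro Max_ge) auto
    have C0: "C \<ge> 0" using C[of 0] k nonneg[of 0] by linarith
    obtain N :: nat where N: "C / (e / 2) < real N" using reals_Archimedean2 by blast
    show "\<exists>no. \<forall>n\<ge>no. norm (a n / real n - L) < e"
    proof (intro exI allI impI)
      fix n assume n: "n \<ge> max 1 N"
      have "L \<le> a n / real n"
        unfolding L_def using n bdd by (intro cINF_lower) auto
      moreover have "a n / real n < L + e"
      proof -
        have "a n \<le> real (n div k) * a k + a (n mod k)"
          using mult[of "n div k" k "n mod k"] by simp
        also have "a (n mod k) \<le> C" using k by (intro C) auto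
        also have "real (n div k) * a k = real (n div k) * real k * (a k / real k)"
          using k by simp
        also have "\<dots> \<le> real n * (a k / real k)"
          using nonneg[of k] by (intro mult_right_mono)
            (auto simp flip: of_nat_mult simp: times_div_less_eq_dividend)
        also have "\<dots> \<le> real n * (L + e / 2)" using k by (intro mult_left_mono) auto
        finally have 1: "a n \<le> real n * (L + e / 2) + C" by simp
        have "C < real N * (e / 2)" using N e by (simp add: field_simps)
        also have "\<dots> \<le> real n * (e / 2)" using n e by (intro mult_right_mono) auto
        finally have "a n < real n * (L + e)" using 1 by (simp add: algebra_simps)
        then show ?thesis using n by (simp add: field_simps)
      qed
      ultimately show "norm (a n / real n - L) < e" by simp
    qed
  qed
  then show ?thesis by (rule convergentI)
qed

text \<open>A \<open>lim\<close> carries information only once convergence is known, which Fekete's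
  lemma supplies. Increments of at least \<open>h\<close> then add up to
  \<open>n * h\<close>.\<close>

lemma garsia_entropy_ge:
  assumes fin: "finite (set_pmf \<nu>)"
    and step: "\<And>n. shannon_entropy (partial_sum_law \<eta> \<nu> n) + h \<le>
                    shannon_entropy (partial_sum_law \<eta> \<nu> (Suc n))"
  shows "garsia_entropy \<eta> \<nu> \<ge> h"
proof -
  let ?a = "\<lambda>n. shannon_entropy (partial_sum_law \<eta> \<nu> n)"
  have nonneg: "?a n \<ge> 0" for n
    by (intro shannon_entropy_nonneg finite_set_partial_sum_law fin)
  have "convergent (\<lambda>n. ?a n / real n)"
    by (rule fekete_convergent)
       (auto intro: shannon_entropy_partial_sum_law_add_le fin nonneg)
  then have lim: "(\<lambda>n. ?a n / real n) \<longlonglongrightarrow> garsia_entropy \<eta> \<nu>"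
    by (simp add: garsia_entropy_def convergent_LIMSEQ_iff)
  have "?a n \<ge> real n * h" for n
  proof (induction n)
    case (Suc n)
    with step[of n] show ?case by (simp add: algebra_simps)
  qed (simp add: nonneg)
  then show ?thesis
    by (intro LIMSEQ_le_const[OF lim] exI[of _ 1]) (auto simp: field_simps)
qed

section \<open>Second moments of independent sums\<close>

lemma expectation_pair_pmf_finite:
  fixes g :: "'a \<times> 'b \<Rightarrow> 'c::{banach, second_countable_topology}"
  assumes "finite (set_pmf X)" "finite (set_pmf Y)"
  shows "measure_pmf.expectation (pair_pmf X Y) g =
           measure_pmf.expectation X (\<lambda>x. measure_pmf.expectation Y (\<lambda>y. g (x, y)))"
proof -
  have "measure_pmf.expectation (pair_pmf X Y) g =
          (\<Sum>(x, y)\<in>set_pmf X \<times> set_pmf Y. (pmf X x * pmf Y y) *\<^sub>R g (x, y))"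
    using assms by (subst expectation_finite_support) (auto simp: pmf_pair intro!: sum.cong)
  then show ?thesis
    using assms
    by (simp add: expectation_finite_support sum.cartesian_product[symmetric] scaleR_sum_right)
qed

lemma finite_set_Pi_pmf:
  assumes "finite I" "finite (set_pmf \<nu>)"
  shows "finite (set_pmf (Pi_pmf I d (\<lambda>_. \<nu>)))"
  using assms by (auto simp: set_Pi_pmf)

text \<open>Centred independent terms are orthogonal. Both claims go through one induction because
  the vanishing mean of the shorter sum removes the cross term.\<close>

lemma second_moment_Pi_pmf:
  fixes z :: "'a \<Rightarrow> complex" and v :: "'i \<Rightarrow> complex"
  assumes "finite I" and fin: "finite (set_pmf \<nu>)"
    and mean: "measure_pmf.expectation \<nu> z = 0"
  shows "measure_pmf.expectation (Pi_pmf I d (\<lambda>_. \<nu>)) (\<lambda>\<xi>. \<Sum>i\<in>I. v i * z (\<xi> i)) = 0 \<and>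
         measure_pmf.expectation (Pi_pmf I d (\<lambda>_. \<nu>)) (\<lambda>\<xi>. (cmod (\<Sum>i\<in>I. v i * z (\<xi> i)))\<^sup>2) =
           (\<Sum>i\<in>I. (cmod (v i))\<^sup>2) * measure_pmf.expectation \<nu> (\<lambda>x. (cmod (z x))\<^sup>2)"
  using assms(1)
proof (induction I)
  case empty
  then show ?case by simp
next
  case (insert k I)
  let ?P = "Pi_pmf I d (\<lambda>_. \<nu>)"
  let ?T = "\<lambda>\<xi>. \<Sum>i\<in>I. v i * z (\<xi> i)"
  have finP: "finite (set_pmf ?P)"
    by (intro finite_set_Pi_pmf insert fin)
  note int = integrable_measure_pmf_finite[OF finP] integrable_measure_pmf_finite[OF fin]
  have upd: "(\<Sum>i\<in>insert k I. v i * z ((\<xi>(k := x)) i)) = v k * z x + ?T \<xi>" for x \<xi>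
  proof -
    have "(\<Sum>i\<in>I. v i * z ((\<xi>(k := x)) i)) = ?T \<xi>"
      using insert by (intro sum.cong) auto
    then show ?thesis using insert by simp
  qed
  \<comment> \<open>The codomain of \<open>g\<close> is polymorphic: the identity and the squared
    modulus are both substituted below.\<close>
  have exp: "measure_pmf.expectation (Pi_pmf (insert k I) d (\<lambda>_. \<nu>)) (\<lambda>\<xi>. g (\<Sum>i\<in>insert k I. v i * z (\<xi> i))) =
      measure_pmf.expectation \<nu> (\<lambda>x. measure_pmf.expectation ?P (\<lambda>\<xi>. g (v k * z x + ?T \<xi>)))"
    for g :: "complex \<Rightarrow> 'c::{banach, second_countable_topology}"
    unfolding Pi_pmf_insert[OF insert.hyps] integral_map_pmf case_prod_unfold upd
    by (subst expectation_pair_pmf_finite[OF fin finP]) simp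
  have T0: "measure_pmf.expectation ?P ?T = 0"
    and T2: "measure_pmf.expectation ?P (\<lambda>\<xi>. (cmod (?T \<xi>))\<^sup>2) =
               (\<Sum>i\<in>I. (cmod (v i))\<^sup>2) * measure_pmf.expectation \<nu> (\<lambda>x. (cmod (z x))\<^sup>2)"
    using insert.IH by auto
  have first: "measure_pmf.expectation (Pi_pmf (insert k I) d (\<lambda>_. \<nu>)) (\<lambda>\<xi>. \<Sum>i\<in>insert k I. v i * z (\<xi> i)) = 0"
    using exp[of "\<lambda>x. x"] by (simp add: int T0 mean)
  have sq: "(cmod (a + b))\<^sup>2 = (cmod a)\<^sup>2 + (cmod b)\<^sup>2 + 2 * Re (cnj a * b)" for a b
    unfolding cmod_power2 by (simp add: power2_eq_square algebra_simps)
  have "measure_pmf.expectation ?P (\<lambda>\<xi>. (cmod (v k * z x + ?T \<xi>))\<^sup>2) =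
          (cmod (v k))\<^sup>2 * (cmod (z x))\<^sup>2 + measure_pmf.expectation ?P (\<lambda>\<xi>. (cmod (?T \<xi>))\<^sup>2)" for x
  proof -
    have "measure_pmf.expectation ?P (\<lambda>\<xi>. Re (cnj (v k * z x) * ?T \<xi>)) =
            Re (measure_pmf.expectation ?P (\<lambda>\<xi>. cnj (v k * z x) * ?T \<xi>))"
      by (rule integral_Re) (rule int)
    also have "measure_pmf.expectation ?P (\<lambda>\<xi>. cnj (v k * z x) * ?T \<xi>) = 0"
      by (simp only: integral_mult_right_zero T0 mult_zero_right)
    finally have "measure_pmf.expectation ?P (\<lambda>\<xi>. Re (cnj (v k * z x) * ?T \<xi>)) = 0" by simp
    then show ?thesis
      unfolding sq by (simp add: int norm_mult power_mult_distrib)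
  qed
  then have "measure_pmf.expectation (Pi_pmf (insert k I) d (\<lambda>_. \<nu>)) (\<lambda>\<xi>. (cmod (\<Sum>i\<in>insert k I. v i * z (\<xi> i)))\<^sup>2) =
      measure_pmf.expectation \<nu> (\<lambda>x. (cmod (v k))\<^sup>2 * (cmod (z x))\<^sup>2 + measure_pmf.expectation ?P (\<lambda>\<xi>. (cmod (?T \<xi>))\<^sup>2))"
    using exp[of "\<lambda>x. (cmod x)\<^sup>2"] by simp
  also have "\<dots> = (\<Sum>i\<in>insert k I. (cmod (v i))\<^sup>2) * measure_pmf.expectation \<nu> (\<lambda>x. (cmod (z x))\<^sup>2)"
    using insert by (simp add: int T2 algebra_simps)
  finally show ?case using first by blast
qed

text \<open>Markov's inequality for the squared modulus. The mean inherits the bound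
  \<open>B\<close> from \<open>s\<close>, so each centred term is at most \<open>2 * B\<close>, and
  orthogonality bounds the second moment of the sum by \<open>(2 * B)\<^sup>2\<close>.\<close>

lemma chebyshev_Pi_pmf:
  fixes s :: "'a \<Rightarrow> complex" and v :: "'i \<Rightarrow> complex"
  assumes "finite I" and fin: "finite (set_pmf \<nu>)"
    and B: "\<And>x. x \<in> set_pmf \<nu> \<Longrightarrow> cmod (s x) \<le> B"
    and v: "(\<Sum>i\<in>I. (cmod (v i))\<^sup>2) \<le> 1" and r: "r > 0"
  defines "\<mu> \<equiv> measure_pmf.expectation \<nu> s"
  shows "measure_pmf.prob (Pi_pmf I d (\<lambda>_. \<nu>)) {\<xi>. cmod (\<Sum>i\<in>I. v i * (s (\<xi> i) - \<mu>)) \<ge> r} \<le>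
           (2 * B / r)\<^sup>2"
proof -
  let ?P = "Pi_pmf I d (\<lambda>_. \<nu>)" and ?z = "\<lambda>x. s x - \<mu>"
  let ?Y = "\<lambda>\<xi>. (cmod (\<Sum>i\<in>I. v i * ?z (\<xi> i)))\<^sup>2"
  have finP: "finite (set_pmf ?P)"
    by (intro finite_set_Pi_pmf assms)
  obtain x0 where "x0 \<in> set_pmf \<nu>" using set_pmf_not_empty[of \<nu>] by blast
  with B have B0: "B \<ge> 0" by (meson norm_ge_zero order_trans)
  have mu: "cmod \<mu> \<le> B"
  proof -
    have "cmod \<mu> \<le> measure_pmf.expectation \<nu> (\<lambda>x. cmod (s x))"
      unfolding \<mu>_def by (rule integral_norm_bound)
    also have "\<dots> \<le> measure_pmf.expectation \<nu> (\<lambda>_. B)"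
      by (intro integral_mono_AE) (auto simp: AE_measure_pmf_iff B integrable_measure_pmf_finite fin)
    finally show ?thesis by simp
  qed
  have mean: "measure_pmf.expectation \<nu> ?z = 0"
    by (simp add: \<mu>_def integrable_measure_pmf_finite fin)
  have "measure_pmf.expectation \<nu> (\<lambda>x. (cmod (?z x))\<^sup>2) \<le> measure_pmf.expectation \<nu> (\<lambda>_. (2 * B)\<^sup>2)"
  proof (intro integral_mono_AE)
    have "cmod (?z x) \<le> 2 * B" if "x \<in> set_pmf \<nu>" for x
      using norm_triangle_ineq4[of "s x" \<mu>] B[OF that] mu by linarith
    then show "AE x in measure_pmf \<nu>. (cmod (?z x))\<^sup>2 \<le> (2 * B)\<^sup>2"
      by (unfold AE_measure_pmf_iff, intro ballI power_mono norm_ge_zero)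
  qed (auto simp: integrable_measure_pmf_finite fin)
  then have var: "measure_pmf.expectation \<nu> (\<lambda>x. (cmod (?z x))\<^sup>2) \<le> (2 * B)\<^sup>2" by simp
  have "measure_pmf.prob ?P {\<xi>. cmod (\<Sum>i\<in>I. v i * ?z (\<xi> i)) \<ge> r} =
          measure_pmf.prob ?P {\<xi> \<in> space (measure_pmf ?P). ?Y \<xi> \<ge> r\<^sup>2}"
    using r by (intro arg_cong[of _ _ "measure_pmf.prob ?P"]) (auto simp: abs_le_square_iff[symmetric])
  also have "\<dots> \<le> measure_pmf.expectation ?P ?Y / r\<^sup>2"
    using r by (intro integral_Markov_inequality_measure[of _ _ "{}"])
               (auto simp: integrable_measure_pmf_finite finP)
  also have "measure_pmf.expectation ?P ?Y =
      (\<Sum>i\<in>I. (cmod (v i))\<^sup>2) * measure_pmf.expectation \<nu> (\<lambda>x. (cmod (?z x))\<^sup>2)"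
    using second_moment_Pi_pmf[OF assms(1) fin mean] by simp
  also have "\<dots> \<le> 1 * (2 * B)\<^sup>2"
    by (intro mult_mono v var) auto
  finally show ?thesis
    using r by (simp add: power_divide divide_right_mono)
qed

section \<open>Primitive minimal polynomials\<close>

abbreviation cpoly :: "int poly \<Rightarrow> complex poly" where
  "cpoly \<equiv> map_poly of_int"

lemma cpoly_eval_simps:
  "poly (cpoly (f * g)) x = poly (cpoly f) x * poly (cpoly g) x"
  "poly (cpoly (f + g)) x = poly (cpoly f) x + poly (cpoly g) x"
  "poly (cpoly (Polynomial.smult c f)) x = of_int c * poly (cpoly f) x"
  by (simp_all add: hom_distribs)

lemma is_int_minpoly_nonzero: "is_int_minpoly \<eta> f \<Longrightarrow> f \<noteq> 0"
  by (auto simp: is_int_minpoly_def)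

text \<open>Pseudo-division leaves a remainder that vanishes at \<open>\<eta>\<close>, hence is zero
  by minimality. Gauss's lemma on contents then removes the factor \<open>c\<close>, because
  \<open>f\<close> is primitive.\<close>

lemma is_int_minpoly_dvd:
  assumes f: "is_int_minpoly \<eta> f" and g: "poly (cpoly g) \<eta> = 0"
  shows "f dvd g"
proof -
  have f0: "f \<noteq> 0" using f by (rule is_int_minpoly_nonzero)
  obtain q r where qr: "pseudo_divmod g f = (q, r)" by force
  define c where "c = lead_coeff f ^ (Suc (degree g) - degree f)"
  have c: "Polynomial.smult c g = f * q + r" and deg: "r = 0 \<or> degree r < degree f"
    using pseudo_divmod[OF f0 qr] by (auto simp: c_def)
  have "poly (cpoly r) \<eta> = 0"
    using arg_cong[OF c, of "\<lambda>p. poly (cpoly p) \<eta>"] f g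
    by (simp add: cpoly_eval_simps is_int_minpoly_def)
  then have "degree f \<le> degree r" if "r \<noteq> 0"
    using that f unfolding is_int_minpoly_def by blast
  with deg have "r = 0" by fastforce
  then have eq: "Polynomial.smult c g = f * q" using c by simp
  have c0: "c \<noteq> 0" using f0 by (simp add: c_def)
  have "content q = normalize c * content g"
    using f arg_cong[OF eq, of content] by (simp add: content_mult is_int_minpoly_def)
  then have "c dvd content q" by simp
  then obtain q' where "q = [:c:] * q'"
    unfolding const_poly_dvd_iff_dvd_content[symmetric] by (elim dvdE)
  then have "Polynomial.smult c g = Polynomial.smult c (f * q')" using eq by simp
  then have "g = f * q'" using c0 by (metis smult_cancel)
  then show ?thesis by simp
qed

lemma is_int_minpoly_unique:
  assumes "is_int_minpoly \<eta> f" "is_int_minpoly \<eta> g"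
  shows "f = g"
proof -
  have "f dvd g" "g dvd f"
    using assms by (auto intro: is_int_minpoly_dvd simp: is_int_minpoly_def)
  then obtain u where u: "g = f * u" "is_unit u"
    using is_int_minpoly_nonzero[OF assms(1)]
    by (metis dvd_def dvd_times_left_cancel_iff mult.right_neutral)
  then obtain a where a: "u = [:a:]" "is_unit a"
    by (auto simp: is_unit_poly_iff)
  then have "a = 1 \<or> a = - 1" by (auto simp: zdvd1_eq)
  then have "a = 1"
    using assms u a by (auto simp: is_int_minpoly_def)
  then show ?thesis using u a by simp
qed

text \<open>An annihilating polynomial of least degree becomes a witness once its content is divided
  out and its sign adjusted. Uniqueness then makes the definite description in
  \<open>int_minpoly\<close> meaningful.\<close>

lemma is_int_minpoly_int_minpoly:
  assumes "algebraic \<eta>"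
  shows "is_int_minpoly \<eta> (int_minpoly \<eta>)"
proof -
  define P where "P f \<longleftrightarrow> f \<noteq> 0 \<and> poly (cpoly f) \<eta> = 0" for f
  obtain f0 where "P f0"
    using assms by (elim algebraicE') (auto simp: P_def)
  then obtain f where f: "P f" and min: "\<And>g. P g \<Longrightarrow> degree f \<le> degree g"
    using ex_has_least_nat[of P f0 degree] by blast
  define g where "g = Polynomial.smult (sgn (lead_coeff f)) (primitive_part f)"
  have f0: "f \<noteq> 0" using f by (simp add: P_def)
  then have s: "sgn (lead_coeff f) = 1 \<or> sgn (lead_coeff f) = - 1" by (auto simp: sgn_if)
  have eq: "f = Polynomial.smult (content f) (primitive_part f)" by simp
  have c: "content f > 0"
    using f0 by (metis content_eq_zero_iff normalize_content abs_ge_zero normalize_int_def order_le_less)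
  have "lead_coeff f = content f * lead_coeff (primitive_part f)"
    using arg_cong[OF eq, of lead_coeff] by (simp only: lead_coeff_smult)
  then have lead: "lead_coeff g > 0"
    using c f0 s by (auto simp: g_def lead_coeff_smult sgn_if zero_less_mult_iff mult_less_0_iff split: if_splits)
  moreover have "content g = 1"
    using s f0 by (auto simp: g_def)
  moreover have prim: "poly (cpoly f) \<eta> = of_int (content f) * poly (cpoly (primitive_part f)) \<eta>"
    by (subst eq) (simp only: cpoly_eval_simps)
  have "of_int (content f) * poly (cpoly (primitive_part f)) \<eta> = 0"
    unfolding prim[symmetric] using f by (simp only: P_def)
  then have "poly (cpoly (primitive_part f)) \<eta> = 0"
    using c f0 by simp
  then have "poly (cpoly g) \<eta> = 0"
    by (simp only: g_def cpoly_eval_simps mult_zero_right)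
  moreover have "degree g = degree f"
    using s by (auto simp: g_def)
  ultimately have "is_int_minpoly \<eta> g"
    using min by (simp add: is_int_minpoly_def P_def)
  then show ?thesis
    unfolding int_minpoly_def by (rule theI) (rule is_int_minpoly_unique[OF _ \<open>is_int_minpoly \<eta> g\<close>])
qed

text \<open>By irreducibility \<open>f\<close> is minimal for its other roots too: it factors as
  \<open>k * h\<close> with \<open>k\<close> minimal for \<open>\<beta>\<close>, and minimality at
  \<open>\<eta>\<close> makes \<open>\<eta>\<close> a root of \<open>k\<close>, since
  \<open>h\<close> has too small a degree.\<close>

lemma is_int_minpoly_root_least:
  assumes f: "is_int_minpoly \<eta> f" and \<beta>: "poly (cpoly f) \<beta> = 0"
    and g: "g \<noteq> 0" "poly (cpoly g) \<beta> = 0"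
  shows "degree f \<le> degree g"
proof -
  have "algebraic \<beta>"
    using g by (intro algebraicI[of "cpoly g"]) auto
  define k where "k = int_minpoly \<beta>"
  have k: "is_int_minpoly \<beta> k"
    unfolding k_def by (rule is_int_minpoly_int_minpoly) fact
  obtain h where h: "f = k * h"
    using is_int_minpoly_dvd[OF k \<beta>] by (elim dvdE)
  have nz: "k \<noteq> 0" "h \<noteq> 0" using is_int_minpoly_nonzero[OF f] h by auto
  have kpos: "degree k > 0"
  proof (rule ccontr)
    assume "\<not> ?thesis"
    then obtain a where "k = [:a:]" by (metis degree_eq_zeroE neq0_conv)
    then show False using k by (auto simp: is_int_minpoly_def)
  qed
  have deg: "degree f = degree k + degree h"
    using nz by (simp add: h degree_mult_eq)
  have "poly (cpoly k) \<eta> = 0 \<or> poly (cpoly h) \<eta> = 0"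
    using f by (auto simp: is_int_minpoly_def h cpoly_eval_simps)
  then have "degree f \<le> degree k"
  proof
    assume "poly (cpoly h) \<eta> = 0"
    then have "degree f \<le> degree h" using f nz by (auto simp: is_int_minpoly_def)
    then show ?thesis using deg kpos by simp
  next
    assume "poly (cpoly k) \<eta> = 0"
    then show ?thesis using f nz unfolding is_int_minpoly_def by blast
  qed
  also have "degree k \<le> degree g" using k g by (auto simp: is_int_minpoly_def)
  finally show ?thesis .
qed

text \<open>The derivative is nonzero and of smaller degree, so it cannot vanish at
  \<open>\<beta>\<close>. This lets products over the list of roots become products over their
  set.\<close>

lemma is_int_minpoly_root_simple:
  assumes f: "is_int_minpoly \<eta> f" and \<beta>: "poly (cpoly f) \<beta> = 0"
  shows "poly (pderiv (cpoly f)) \<beta> \<noteq> 0"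
proof
  assume "poly (pderiv (cpoly f)) \<beta> = 0"
  moreover have "pderiv (cpoly f) = cpoly (pderiv f)"
    by (simp add: of_int_hom.map_poly_pderiv)
  ultimately have der: "poly (cpoly (pderiv f)) \<beta> = 0" by simp
  have "degree f > 0"
  proof (rule ccontr)
    assume "\<not> ?thesis"
    then obtain a where "f = [:a:]" by (metis degree_eq_zeroE neq0_conv)
    then show False using f by (auto simp: is_int_minpoly_def)
  qed
  then have "pderiv f \<noteq> 0" "degree (pderiv f) < degree f"
    by (auto simp: pderiv_eq_0_iff degree_pderiv)
  with is_int_minpoly_root_least[OF f \<beta> _ der] show False by simp
qed

section \<open>Extension of ring embeddings\<close>

text \<open>An embedding of a subring \<open>R\<close> of the complex numbers into the complex
  numbers, with \<open>\<phi>\<close> arbitrary off \<open>R\<close>. Rings instead of number fields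
  avoid inverses, at the price of pseudo-division.\<close>

locale ring_embedding =
  fixes R :: "complex set" and \<phi> :: "complex \<Rightarrow> complex"
  assumes one_mem: "1 \<in> R"
    and diff_mem: "x \<in> R \<Longrightarrow> y \<in> R \<Longrightarrow> x - y \<in> R"
    and mult_mem: "x \<in> R \<Longrightarrow> y \<in> R \<Longrightarrow> x * y \<in> R"
    and hom_one: "\<phi> 1 = 1"
    and hom_diff: "x \<in> R \<Longrightarrow> y \<in> R \<Longrightarrow> \<phi> (x - y) = \<phi> x - \<phi> y"
    and hom_mult: "x \<in> R \<Longrightarrow> y \<in> R \<Longrightarrow> \<phi> (x * y) = \<phi> x * \<phi> y"
    and hom_eq_0D: "x \<in> R \<Longrightarrow> \<phi> x = 0 \<Longrightarrow> x = 0"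
begin

lemma zero_mem: "0 \<in> R"
  using diff_mem[OF one_mem one_mem] by simp

lemma uminus_mem: "x \<in> R \<Longrightarrow> - x \<in> R"
  using diff_mem[OF zero_mem] by simp

lemma add_mem: "x \<in> R \<Longrightarrow> y \<in> R \<Longrightarrow> x + y \<in> R"
  using diff_mem[OF _ uminus_mem, of x y] by simp

lemma hom_zero: "\<phi> 0 = 0"
  using hom_diff[OF one_mem one_mem] by simp

lemma hom_uminus: "x \<in> R \<Longrightarrow> \<phi> (- x) = - \<phi> x"
  using hom_diff[OF zero_mem] by (simp add: hom_zero)

lemma hom_add: "x \<in> R \<Longrightarrow> y \<in> R \<Longrightarrow> \<phi> (x + y) = \<phi> x + \<phi> y"
  using hom_diff[OF _ uminus_mem, of x y] by (simp add: hom_uminus)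

lemma sum_mem: "(\<And>i. i \<in> I \<Longrightarrow> g i \<in> R) \<Longrightarrow> sum g I \<in> R"
  by (induction I rule: infinite_finite_induct) (auto simp: zero_mem add_mem)

lemma hom_sum: "(\<And>i. i \<in> I \<Longrightarrow> g i \<in> R) \<Longrightarrow> \<phi> (sum g I) = (\<Sum>i\<in>I. \<phi> (g i))"
  by (induction I rule: infinite_finite_induct) (auto simp: hom_zero hom_add sum_mem)

lemma power_mem: "x \<in> R \<Longrightarrow> x ^ n \<in> R"
  by (induction n) (auto simp: one_mem mult_mem)

lemma hom_power: "x \<in> R \<Longrightarrow> \<phi> (x ^ n) = \<phi> x ^ n"
  by (induction n) (auto simp: hom_one hom_mult power_mem)

lemma hom_eq_iff: "x \<in> R \<Longrightarrow> y \<in> R \<Longrightarrow> \<phi> x = \<phi> y \<longleftrightarrow> x = y"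
  using hom_eq_0D[OF diff_mem, of x y] by (auto simp: hom_diff)

lemma of_nat_mem_hom: "of_nat n \<in> R \<and> \<phi> (of_nat n) = of_nat n"
  by (induction n) (auto simp: zero_mem one_mem add_mem hom_zero hom_one hom_add)

lemma of_int_mem_hom: "of_int k \<in> R \<and> \<phi> (of_int k) = of_int k"
proof (cases k rule: int_cases2)
  case (nonneg n)
  then show ?thesis using of_nat_mem_hom[of n] by simp
next
  case (nonpos n)
  then show ?thesis using of_nat_mem_hom[of n] by (simp add: uminus_mem hom_uminus)
qed

section \<open>Polynomials over the domain of an embedding\<close>

definition Rpoly :: "complex poly \<Rightarrow> bool" where
  "Rpoly p \<longleftrightarrow> (\<forall>i. Polynomial.coeff p i \<in> R)"

lemma Rpoly_0: "Rpoly 0"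
  by (simp add: Rpoly_def zero_mem)

lemma Rpoly_diff: "Rpoly p \<Longrightarrow> Rpoly q \<Longrightarrow> Rpoly (p - q)"
  by (simp add: Rpoly_def diff_mem)

lemma Rpoly_add: "Rpoly p \<Longrightarrow> Rpoly q \<Longrightarrow> Rpoly (p + q)"
  by (simp add: Rpoly_def add_mem)

lemma Rpoly_mult: "Rpoly p \<Longrightarrow> Rpoly q \<Longrightarrow> Rpoly (p * q)"
  by (simp add: Rpoly_def coeff_mult sum_mem mult_mem)

lemma Rpoly_smult: "c \<in> R \<Longrightarrow> Rpoly p \<Longrightarrow> Rpoly (Polynomial.smult c p)"
  by (simp add: Rpoly_def mult_mem)

lemma Rpoly_monom: "c \<in> R \<Longrightarrow> Rpoly (Polynomial.monom c n)"
  by (simp add: Rpoly_def zero_mem)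

lemma Rpoly_pCons: "c \<in> R \<Longrightarrow> Rpoly p \<Longrightarrow> Rpoly (pCons c p)"
  by (auto simp: Rpoly_def coeff_pCons split: nat.splits)

lemma Rpoly_cpoly: "Rpoly (cpoly f)"
  by (simp add: Rpoly_def of_int_mem_hom)

lemma coeff_map_poly_hom: "Polynomial.coeff (map_poly \<phi> p) i = \<phi> (Polynomial.coeff p i)"
  by (simp add: coeff_map_poly hom_zero)

lemma map_poly_hom_cpoly: "map_poly \<phi> (cpoly f) = cpoly f"
  by (rule poly_eqI) (simp add: coeff_map_poly_hom of_int_mem_hom)

lemma map_poly_hom_diff:
  "Rpoly p \<Longrightarrow> Rpoly q \<Longrightarrow> map_poly \<phi> (p - q) = map_poly \<phi> p - map_poly \<phi> q"
  by (rule poly_eqI) (simp add: coeff_map_poly_hom hom_diff Rpoly_def)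

lemma map_poly_hom_add:
  "Rpoly p \<Longrightarrow> Rpoly q \<Longrightarrow> map_poly \<phi> (p + q) = map_poly \<phi> p + map_poly \<phi> q"
  by (rule poly_eqI) (simp add: coeff_map_poly_hom hom_add Rpoly_def)

lemma map_poly_hom_mult:
  "Rpoly p \<Longrightarrow> Rpoly q \<Longrightarrow> map_poly \<phi> (p * q) = map_poly \<phi> p * map_poly \<phi> q"
  by (rule poly_eqI) (simp add: coeff_map_poly_hom coeff_mult hom_sum hom_mult mult_mem Rpoly_def)

lemma map_poly_hom_smult:
  "c \<in> R \<Longrightarrow> Rpoly p \<Longrightarrow> map_poly \<phi> (Polynomial.smult c p) = Polynomial.smult (\<phi> c) (map_poly \<phi> p)"
  by (rule poly_eqI) (simp add: coeff_map_poly_hom hom_mult Rpoly_def)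

lemma hom_poly:
  assumes "x \<in> R"
  shows "Rpoly p \<Longrightarrow> poly p x \<in> R \<and> \<phi> (poly p x) = poly (map_poly \<phi> p) (\<phi> x)"
proof (induction p)
  case (pCons a p)
  then have "a \<in> R" "Rpoly p" by (auto simp: Rpoly_def coeff_pCons split: nat.splits)
  then show ?case
    using pCons assms by (simp add: map_poly_pCons hom_zero add_mem mult_mem hom_add hom_mult)
qed (simp add: zero_mem hom_zero)

lemma degree_map_poly_hom:
  assumes "Rpoly p"
  shows "degree (map_poly \<phi> p) = degree p"
proof (cases "p = 0")
  case False
  then have "\<phi> (lead_coeff p) \<noteq> 0"
    using assms hom_eq_0D[of "lead_coeff p"] by (auto simp: Rpoly_def)
  then show ?thesis
    by (intro antisym le_degree degree_le) (auto simp: coeff_map_poly_hom coeff_eq_0 hom_zero)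
qed simp

text \<open>Long division in which every step first multiplies by the leading coefficient of
  \<open>g\<close>, as this may have no inverse in \<open>R\<close>. The induction runs over a bound
  \<open>n\<close> for the degree.\<close>

lemma pseudo_division:
  assumes g: "Rpoly g" "g \<noteq> 0" and p: "Rpoly p"
  shows "\<exists>k q r. Rpoly q \<and> Rpoly r \<and> Polynomial.smult (lead_coeff g ^ k) p = g * q + r \<and>
           (r = 0 \<or> degree r < degree g)"
proof -
  have "p = 0 \<or> degree p < n \<Longrightarrow> Rpoly p \<Longrightarrow> ?thesis" for n
  proof (induction n arbitrary: p)
    case 0
    then show ?case by (intro exI[of _ 0]) (auto simp: Rpoly_0)
  next
    case (Suc n)
    show ?case
    proof (cases "p = 0 \<or> degree p < degree g")
      case True
      then show ?thesis
        using Suc.prems by (intro exI[of _ 0] exI[of _ p]) (auto simp: Rpoly_0)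
    next
      case False
      define c where "c = lead_coeff g"
      define m where "m = Polynomial.monom (lead_coeff p) (degree p - degree g)"
      \<comment> \<open>The leading terms of the two summands cancel.\<close>
      define p' where "p' = Polynomial.smult c p - m * g"
      have c: "c \<in> R" using g by (simp add: c_def Rpoly_def)
      have m: "Rpoly m" unfolding m_def
        using Suc.prems by (intro Rpoly_monom) (simp add: Rpoly_def)
      have p': "Rpoly p'"
        unfolding p'_def by (intro Rpoly_diff Rpoly_smult Rpoly_mult c m Suc.prems g)
      have "degree p' \<le> degree p"
        unfolding p'_def
      proof (rule degree_diff_le)
        have "degree (m * g) \<le> degree m + degree g" by (rule degree_mult_le)
        also have "degree m \<le> degree p - degree g" by (simp add: m_def degree_monom_le)
        finally show "degree (m * g) \<le> degree p" using False by simp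
      qed (rule degree_smult_le)
      moreover have "Polynomial.coeff p' (degree p) = 0"
        using False by (simp add: p'_def m_def c_def coeff_monom_mult)
      ultimately have "p' = 0 \<or> degree p' < degree p"
        by (rule eq_zero_or_degree_less)
      then have "p' = 0 \<or> degree p' < n"
        using Suc.prems False by auto
      from Suc.IH[OF this p'] obtain k q r where *: "Rpoly q" "Rpoly r"
        "Polynomial.smult (c ^ k) p' = g * q + r" "r = 0 \<or> degree r < degree g"
        unfolding c_def by blast
      have "Polynomial.smult (c ^ Suc k) p = Polynomial.smult (c ^ k) p' + Polynomial.smult (c ^ k) m * g"
        by (simp add: p'_def smult_diff_right mult.commute)
      also have "\<dots> = g * (q + Polynomial.smult (c ^ k) m) + r"
        by (simp add: *(3) algebra_simps)
      finally have "Polynomial.smult (c ^ Suc k) p = g * (q + Polynomial.smult (c ^ k) m) + r" .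
      moreover have "Rpoly (q + Polynomial.smult (c ^ k) m)"
        using * c m by (intro Rpoly_add Rpoly_smult power_mem)
      ultimately show ?thesis
        unfolding c_def[symmetric] using *(2,4) by blast
    qed
  qed
  then show ?thesis using p by blast
qed

section \<open>Adjoining one algebraic element\<close>

context
  fixes \<tau> \<tau>' :: complex and g :: "complex poly"
  assumes g: "Rpoly g" "g \<noteq> 0" "poly g \<tau> = 0"
    and least: "\<And>p. Rpoly p \<Longrightarrow> p \<noteq> 0 \<Longrightarrow> poly p \<tau> = 0 \<Longrightarrow> degree g \<le> degree p"
    and root: "poly (map_poly \<phi> g) \<tau>' = 0"
begin

text \<open>This makes the extension well defined. By minimality the pseudo-remainder of
  \<open>p\<close> by \<open>g\<close> is zero, so a nonzero multiple of \<open>p\<close> is a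
  multiple of \<open>g\<close>, and this survives \<open>\<phi>\<close>.\<close>

lemma hom_root:
  assumes p: "Rpoly p" "poly p \<tau> = 0"
  shows "poly (map_poly \<phi> p) \<tau>' = 0"
proof -
  define c where "c = lead_coeff g"
  have c: "c \<in> R" "c \<noteq> 0" using g by (auto simp: c_def Rpoly_def)
  obtain k q r where *: "Rpoly q" "Rpoly r"
    "Polynomial.smult (c ^ k) p = g * q + r" "r = 0 \<or> degree r < degree g"
    unfolding c_def using pseudo_division[OF g(1,2) p(1)] by blast
  have "poly r \<tau> = 0"
    using arg_cong[OF *(3), of "\<lambda>p. poly p \<tau>"] g p by simp
  then have "r = 0" using least[OF *(2)] *(4) by force
  have "Polynomial.smult (\<phi> (c ^ k)) (map_poly \<phi> p) = map_poly \<phi> (Polynomial.smult (c ^ k) p)"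
    by (rule map_poly_hom_smult[symmetric]) (intro power_mem c p)+
  also have "\<dots> = map_poly \<phi> g * map_poly \<phi> q"
    using *(3) \<open>r = 0\<close> map_poly_hom_mult[OF g(1) *(1)] by simp
  finally have "Polynomial.smult (\<phi> (c ^ k)) (map_poly \<phi> p) = map_poly \<phi> g * map_poly \<phi> q" .
  then have "\<phi> (c ^ k) * poly (map_poly \<phi> p) \<tau>' = 0"
    using root by (metis mult_zero_left poly_mult poly_smult)
  then show ?thesis
    using c hom_eq_0D[OF power_mem[OF c(1)], of k] by auto
qed

text \<open>This makes the extension injective. A polynomial \<open>u\<close> of least degree whose
  image vanishes at \<open>\<tau>'\<close> divides \<open>p\<close> up to a nonzero constant, so it
  suffices that \<open>u\<close> vanishes at \<open>\<tau>\<close>.\<close>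

lemma hom_rootD:
  assumes p: "Rpoly p" "poly (map_poly \<phi> p) \<tau>' = 0"
  shows "poly p \<tau> = 0"
proof -
  define P where "P u \<longleftrightarrow> Rpoly u \<and> u \<noteq> 0 \<and> poly (map_poly \<phi> u) \<tau>' = 0" for u
  have "P g" using g root by (simp add: P_def)
  then obtain u where u: "P u" and u_least: "\<And>q. P q \<Longrightarrow> degree u \<le> degree q"
    using ex_has_least_nat[of P g degree] by blast
  define c where "c = lead_coeff u"
  have c: "c \<in> R" "c \<noteq> 0" using u by (auto simp: c_def P_def Rpoly_def)
  have div: "\<exists>k q. Rpoly q \<and> Polynomial.smult (c ^ k) p = u * q"
    if p: "Rpoly p" "poly (map_poly \<phi> p) \<tau>' = 0" for p
  proof -
    obtain k q r where *: "Rpoly q" "Rpoly r"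
      "Polynomial.smult (c ^ k) p = u * q + r" "r = 0 \<or> degree r < degree u"
      unfolding c_def using pseudo_division[of u p] u p by (auto simp: P_def)
    have uR: "Rpoly u" using u by (simp add: P_def)
    have "Polynomial.smult (\<phi> (c ^ k)) (map_poly \<phi> p) = map_poly \<phi> (Polynomial.smult (c ^ k) p)"
      by (rule map_poly_hom_smult[symmetric]) (intro power_mem c p)+
    also have "\<dots> = map_poly \<phi> u * map_poly \<phi> q + map_poly \<phi> r"
      unfolding *(3) map_poly_hom_add[OF Rpoly_mult[OF uR *(1)] *(2)] map_poly_hom_mult[OF uR *(1)] ..
    finally have "Polynomial.smult (\<phi> (c ^ k)) (map_poly \<phi> p) =
                    map_poly \<phi> u * map_poly \<phi> q + map_poly \<phi> r" .
    from arg_cong[OF this, of "\<lambda>p. poly p \<tau>'"] have "poly (map_poly \<phi> r) \<tau>' = 0"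
      using u p by (simp add: P_def)
    then have "r = 0" using u_least[of r] *(2,4) by (force simp: P_def)
    then show ?thesis using * by auto
  qed
  obtain k q where q: "Rpoly q" "Polynomial.smult (c ^ k) g = u * q"
    using div[OF g(1) root] by blast
  \<comment> \<open>Otherwise the cofactor \<open>q\<close> of \<open>u\<close> in a multiple of
    \<open>g\<close> vanishes at \<open>\<tau>\<close>. Minimality of \<open>g\<close> then makes
    \<open>u\<close> a nonzero constant, whose image cannot be zero.\<close>
  have "poly u \<tau> = 0"
  proof (rule ccontr)
    assume *: "poly u \<tau> \<noteq> 0"
    have "poly q \<tau> = 0"
      using arg_cong[OF q(2), of "\<lambda>p. poly p \<tau>"] g * by simp
    moreover have "q \<noteq> 0" using q g c by auto
    ultimately have "degree g \<le> degree q" by (intro least q)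
    moreover have "degree g = degree u + degree q"
      using arg_cong[OF q(2), of degree] c u \<open>q \<noteq> 0\<close> by (simp add: degree_mult_eq P_def)
    ultimately have "degree u = 0" by simp
    then obtain a where a: "u = [:a:]" by (rule degree_eq_zeroE)
    then have "a \<in> R" "\<phi> a = 0"
      using u by (auto simp: P_def Rpoly_def map_poly_pCons hom_zero dest: spec[of _ 0])
    then show False using hom_eq_0D u a by (auto simp: P_def)
  qed
  then show ?thesis
    using div[OF p] c by (metis mult_eq_0_iff poly_mult poly_smult power_eq_0_iff)
qed

text \<open>The extension sends \<open>poly p \<tau>\<close> to
  \<open>poly (map_poly \<phi> p) \<tau>'\<close>; \<open>hom_root\<close> makes it independent of
  the chosen \<open>p\<close>, and \<open>hom_rootD\<close> gives a trivial kernel.\<close>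

lemma ex_extension_root:
  "\<exists>R' \<phi>'. ring_embedding R' \<phi>' \<and> (\<forall>x\<in>R. x \<in> R' \<and> \<phi>' x = \<phi> x) \<and> \<tau> \<in> R' \<and> \<phi>' \<tau> = \<tau>'"
proof -
  define R' where "R' = {poly p \<tau> |p. Rpoly p}"
  define \<phi>' where "\<phi>' x = poly (map_poly \<phi> (SOME p. Rpoly p \<and> poly p \<tau> = x)) \<tau>'" for x
  have hom_poly: "\<phi>' (poly p \<tau>) = poly (map_poly \<phi> p) \<tau>'" if p: "Rpoly p" for p
  proof -
    define q where "q = (SOME q. Rpoly q \<and> poly q \<tau> = poly p \<tau>)"
    have q: "Rpoly q \<and> poly q \<tau> = poly p \<tau>"
      unfolding q_def by (rule someI[of _ p]) (simp add: p)
    then have "poly (map_poly \<phi> (q - p)) \<tau>' = 0"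
      by (intro hom_root Rpoly_diff p) auto
    then show ?thesis
      using p q by (simp add: \<phi>'_def q_def[symmetric] map_poly_hom_diff)
  qed
  have const: "Rpoly [:x:]" if "x \<in> R" for x
    using that by (intro Rpoly_pCons Rpoly_0)
  have const_hom: "x \<in> R' \<and> \<phi>' x = \<phi> x" if x: "x \<in> R" for x
  proof
    show "x \<in> R'" unfolding R'_def using const[OF x] by force
    show "\<phi>' x = \<phi> x"
      using hom_poly[OF const[OF x]] by (cases "x = 0") (simp_all add: map_poly_pCons hom_zero)
  qed
  have X: "Rpoly [:0, 1:]" by (intro Rpoly_pCons Rpoly_0 zero_mem one_mem)
  have "\<tau> \<in> R'" unfolding R'_def using X by force
  moreover have "\<phi>' \<tau> = \<tau>'"
    using hom_poly[OF X] by (simp add: map_poly_pCons hom_zero hom_one)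
  moreover have "ring_embedding R' \<phi>'"
  proof
    show "1 \<in> R'" "\<phi>' 1 = 1" using const_hom[OF one_mem] by (auto simp: hom_one)
    fix x assume "x \<in> R'"
    then obtain p where p: "Rpoly p" "x = poly p \<tau>" by (auto simp: R'_def)
    show "x = 0" if "\<phi>' x = 0"
      using that p hom_rootD by (simp add: hom_poly)
    fix y assume "y \<in> R'"
    then obtain q where q: "Rpoly q" "y = poly q \<tau>" by (auto simp: R'_def)
    have *: "x - y = poly (p - q) \<tau>" "x * y = poly (p * q) \<tau>" using p q by auto
    show "x - y \<in> R'" "x * y \<in> R'"
      unfolding R'_def * using p q Rpoly_diff Rpoly_mult by blast+
    show "\<phi>' (x - y) = \<phi>' x - \<phi>' y"
      unfolding *(1) hom_poly[OF Rpoly_diff[OF p(1) q(1)]] using p q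
      by (simp add: hom_poly map_poly_hom_diff)
    show "\<phi>' (x * y) = \<phi>' x * \<phi>' y"
      unfolding *(2) hom_poly[OF Rpoly_mult[OF p(1) q(1)]] using p q
      by (simp add: hom_poly map_poly_hom_mult)
  qed
  ultimately show ?thesis using const_hom by blast
qed

end

text \<open>The image of \<open>\<tau>\<close> can be any root of the image of its minimal
  polynomial over \<open>R\<close>. Such a root exists because \<open>\<phi>\<close> preserves the
  degree and the complex numbers are algebraically closed.\<close>

lemma ex_extension:
  assumes "algebraic \<tau>"
  shows "\<exists>R' \<phi>'. ring_embedding R' \<phi>' \<and> (\<forall>x\<in>R. x \<in> R' \<and> \<phi>' x = \<phi> x) \<and> \<tau> \<in> R'"
proof -
  define P where "P u \<longleftrightarrow> Rpoly u \<and> u \<noteq> 0 \<and> poly u \<tau> = 0" for u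
  obtain f where "f \<noteq> 0" "poly (cpoly f) \<tau> = 0"
    using assms by (rule algebraicE')
  then have "P (cpoly f)" by (simp add: P_def Rpoly_cpoly)
  then obtain g where g: "P g" and least: "\<And>q. P q \<Longrightarrow> degree g \<le> degree q"
    using ex_has_least_nat[of P _ degree] by blast
  have "degree g \<noteq> 0"
  proof
    assume "degree g = 0"
    then obtain a where "g = [:a:]" by (rule degree_eq_zeroE)
    then show False using g by (auto simp: P_def)
  qed
  then have "degree (map_poly \<phi> g) \<noteq> 0"
    using g by (simp add: P_def degree_map_poly_hom)
  then obtain \<tau>' where root: "poly (map_poly \<phi> g) \<tau>' = 0"
    using fundamental_theorem_of_algebra[of "map_poly \<phi> g"] by (auto simp: constant_degree)
  have *: "Rpoly g" "g \<noteq> 0" "poly g \<tau> = 0" using g by (auto simp: P_def)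
  have "\<And>p. Rpoly p \<Longrightarrow> p \<noteq> 0 \<Longrightarrow> poly p \<tau> = 0 \<Longrightarrow> degree g \<le> degree p"
    using least by (auto simp: P_def)
  from ex_extension_root[OF * this root] show ?thesis by blast
qed

end

text \<open>The tower starts with the identity on the integers. Over them \<open>cpoly f\<close> has
  least degree at \<open>\<eta>\<close>, so \<open>\<eta>\<close> may be sent to any root
  \<open>\<beta>\<close>; the elements of \<open>T\<close> are then adjoined one at a time.\<close>

lemma ex_ring_embedding:
  assumes f: "is_int_minpoly \<eta> f" and \<beta>: "poly (cpoly f) \<beta> = 0"
    and "finite T" and alg: "\<And>t. t \<in> T \<Longrightarrow> algebraic t"
  shows "\<exists>R \<phi>. ring_embedding R \<phi> \<and> \<eta> \<in> R \<and> \<phi> \<eta> = \<beta> \<and> T \<subseteq> R"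
  using assms(3,4)
proof (induction T)
  case empty
  have Z: "ring_embedding \<int> id"
    by (rule ring_embedding.intro) simp_all
  have "ring_embedding.Rpoly \<int> (cpoly f)" "cpoly f \<noteq> 0" "poly (cpoly f) \<eta> = 0"
    using f is_int_minpoly_nonzero[OF f] by (auto simp: ring_embedding.Rpoly_cpoly[OF Z] is_int_minpoly_def)
  note * = this
  have least: "degree (cpoly f) \<le> degree p" if p: "ring_embedding.Rpoly \<int> p" "p \<noteq> 0" "poly p \<eta> = 0" for p
  proof -
    have "\<And>i. Polynomial.coeff p i \<in> \<int>" using p(1) by (simp add: ring_embedding.Rpoly_def[OF Z])
    then obtain q where "p = cpoly q" by (rule intpolyE)
    then show ?thesis using f p by (auto simp: is_int_minpoly_def)
  qed
  have root: "poly (map_poly id (cpoly f)) \<beta> = 0" using \<beta> by (simp add: map_poly_id)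
  show ?case using ring_embedding.ex_extension_root[OF Z * least root] by blast
next
  case (insert t T)
  then obtain R \<phi> where R: "ring_embedding R \<phi>" "\<eta> \<in> R" "\<phi> \<eta> = \<beta>" "T \<subseteq> R" by auto
  show ?case using ring_embedding.ex_extension[OF R(1), of t] insert.prems R by (metis insert_iff insert_subset subset_iff)
qed

section \<open>Integer spans\<close>

definition zspan :: "complex set \<Rightarrow> complex set" where
  "zspan W = {x. \<exists>c. x = (\<Sum>w\<in>W. of_int (c w) * w)}"

text \<open>The multiplier ring of the module \<open>zspan W\<close>. It stands in for an order of a
  number field: for finite \<open>W\<close> each element acts on \<open>W\<close> by an integer
  matrix.\<close>

definition zstab :: "complex set \<Rightarrow> complex set" where
  "zstab W = {x. \<forall>w\<in>W. x * w \<in> zspan W}"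

lemma zspanI: "x = (\<Sum>w\<in>W. of_int (c w) * w) \<Longrightarrow> x \<in> zspan W"
  unfolding zspan_def by auto

lemma zspan_0: "0 \<in> zspan W"
  unfolding zspan_def by (auto intro!: exI[of _ "\<lambda>_. 0"])

lemma zspan_base:
  assumes "finite W" "w \<in> W"
  shows "w \<in> zspan W"
proof -
  have "(\<Sum>v\<in>W. of_int (if v = w then 1 else 0) * v) = (\<Sum>v\<in>W. if v = w then v else 0)"
    by (intro sum.cong) auto
  then have "w = (\<Sum>v\<in>W. of_int (if v = w then 1 else 0) * v)"
    using assms by simp
  then show ?thesis by (rule zspanI)
qed

lemma zspan_add:
  assumes "x \<in> zspan W" "y \<in> zspan W"
  shows "x + y \<in> zspan W"
proof -
  obtain c d where "x = (\<Sum>w\<in>W. of_int (c w) * w)" "y = (\<Sum>w\<in>W. of_int (d w) * w)"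
    using assms unfolding zspan_def by blast
  then have "x + y = (\<Sum>w\<in>W. of_int (c w + d w) * w)"
    by (simp add: sum.distrib distrib_right)
  then show ?thesis by (rule zspanI)
qed

lemma zspan_of_int_mult:
  assumes "x \<in> zspan W"
  shows "of_int k * x \<in> zspan W"
proof -
  obtain c where "x = (\<Sum>w\<in>W. of_int (c w) * w)"
    using assms unfolding zspan_def by blast
  then have "of_int k * x = (\<Sum>w\<in>W. of_int (k * c w) * w)"
    by (simp add: sum_distrib_left mult.assoc)
  then show ?thesis by (rule zspanI)
qed

lemma zspan_sum: "(\<And>i. i \<in> I \<Longrightarrow> g i \<in> zspan W) \<Longrightarrow> sum g I \<in> zspan W"
  by (induction I rule: infinite_finite_induct) (auto simp: zspan_0 zspan_add)

lemma zspan_mult_subset: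
  assumes "x \<in> zspan W" "\<And>w. w \<in> W \<Longrightarrow> w * y \<in> zspan V"
  shows "x * y \<in> zspan V"
proof -
  obtain c where "x = (\<Sum>w\<in>W. of_int (c w) * w)"
    using assms unfolding zspan_def by blast
  then have "x * y = (\<Sum>w\<in>W. of_int (c w) * (w * y))"
    by (simp add: sum_distrib_right mult.assoc)
  also have "\<dots> \<in> zspan V" by (intro zspan_sum zspan_of_int_mult assms)
  finally show ?thesis .
qed

lemma zstab_mult_zspan: "x \<in> zstab W \<Longrightarrow> y \<in> zspan W \<Longrightarrow> x * y \<in> zspan W"
  using zspan_mult_subset[of y W x W] by (simp add: zstab_def mult.commute)

lemma zstab_add: "x \<in> zstab W \<Longrightarrow> y \<in> zstab W \<Longrightarrow> x + y \<in> zstab W"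
  by (simp add: zstab_def distrib_right zspan_add)

lemma zstab_mult: "x \<in> zstab W \<Longrightarrow> y \<in> zstab W \<Longrightarrow> x * y \<in> zstab W"
  unfolding zstab_def using zstab_mult_zspan[of x W] by (auto simp: zstab_def mult.assoc)

lemma zstab_of_int: "finite W \<Longrightarrow> of_int k \<in> zstab W"
  by (simp add: zstab_def zspan_of_int_mult zspan_base)

lemma zstab_diff: "finite W \<Longrightarrow> x \<in> zstab W \<Longrightarrow> y \<in> zstab W \<Longrightarrow> x - y \<in> zstab W"
  using zstab_add[OF _ zstab_mult[OF zstab_of_int[of W "- 1"]], of x y] by simp

lemma zstab_cpoly: "finite W \<Longrightarrow> x \<in> zstab W \<Longrightarrow> poly (cpoly p) x \<in> zstab W"
proof (induction p)
  case 0
  then show ?case using zstab_of_int[of W 0] by simp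
next
  case (pCons a p)
  then show ?case using zstab_of_int[of W a] by (simp add: map_poly_pCons zstab_add zstab_mult)
qed

text \<open>\<open>W\<close> consists of the monomials of small degree in the elements of \<open>T\<close>; the denominator \<open>c\<close> clears
  the leading coefficients of their minimal polynomials.\<close>

lemma ex_zstab:
  assumes "finite T" "\<And>t. t \<in> T \<Longrightarrow> algebraic t"
  shows "\<exists>W c. finite W \<and> 1 \<in> W \<and> c \<noteq> 0 \<and> (\<forall>t\<in>T. of_int c * t \<in> zstab W)"
  using assms
proof (induction T)
  case empty
  show ?case by (intro exI[of _ "{1}"] exI[of _ 1]) auto
next
  case (insert \<tau> T)
  then obtain W c where W: "finite W" "1 \<in> W" "c \<noteq> 0" "\<forall>t\<in>T. of_int c * t \<in> zstab W"
    by auto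
  obtain q where q: "q \<noteq> 0" "poly (cpoly q) \<tau> = 0"
    using insert.prems by (auto elim: algebraicE')
  define d where "d = degree q"
  define a where "a = lead_coeff q"
  have d: "d > 0"
  proof (rule ccontr)
    assume "\<not> ?thesis"
    then obtain b where "q = [:b:]" by (metis d_def degree_eq_zeroE neq0_conv)
    then show False using q by auto
  qed
  define V where "V = (\<lambda>(w, e). w * \<tau> ^ e) ` (W \<times> {..<d})"
  have V: "finite V" using W by (simp add: V_def)
  have VI: "w * \<tau> ^ e \<in> zspan V" if "w \<in> W" "e < d" for w e
    using that by (intro zspan_base V) (force simp: V_def)
  have "1 \<in> V" unfolding V_def using W d by force
  \<comment> \<open>Multipliers of the old module act on the first factor of each generator and
    leave the power of \<open>\<tau>\<close> alone.\<close>
  have lift: "x \<in> zstab V" if "x \<in> zstab W" for x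
    unfolding zstab_def
  proof (intro CollectI ballI)
    fix v assume "v \<in> V"
    then obtain w e where v: "v = w * \<tau> ^ e" "w \<in> W" "e < d" by (auto simp: V_def)
    have "x * w \<in> zspan W" using that v by (simp add: zstab_def)
    then have "(x * w) * \<tau> ^ e \<in> zspan V" by (rule zspan_mult_subset) (intro VI v)
    then show "x * v \<in> zspan V" by (simp add: v mult.assoc)
  qed
  have "of_int a * \<tau> \<in> zstab V"
    unfolding zstab_def
  proof (intro CollectI ballI)
    fix v assume "v \<in> V"
    then obtain w e where v: "v = w * \<tau> ^ e" "w \<in> W" "e < d" by (auto simp: V_def)
    show "of_int a * \<tau> * v \<in> zspan V"
    proof (cases "Suc e < d")
      case True
      then show ?thesis
        using zspan_of_int_mult[OF VI[OF v(2) True], of a] by (simp add: v mult_ac)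
    next
      case False
      then have e: "d = Suc e" using v by simp
      \<comment> \<open>At the top exponent the relation \<open>poly (cpoly q) \<tau> = 0\<close>
        rewrites \<open>a * \<tau> ^ d\<close> in lower powers.\<close>
      have "(\<Sum>i\<le>d. of_int (Polynomial.coeff q i) * \<tau> ^ i) = 0"
        using q(2) by (simp add: poly_altdef d_def)
      then have "(\<Sum>i<d. of_int (Polynomial.coeff q i) * \<tau> ^ i) = - (of_int a * \<tau> ^ d)"
        by (simp add: a_def d_def lessThan_Suc_atMost[symmetric] eq_neg_iff_add_eq_0)
      then have "of_int a * \<tau> * v = of_int (- 1) * (\<Sum>i<d. of_int (Polynomial.coeff q i) * \<tau> ^ i) * w"
        by (simp add: v e mult_ac)
      also have "\<dots> = of_int (- 1) * (\<Sum>i<d. of_int (Polynomial.coeff q i) * (w * \<tau> ^ i))"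
        by (simp add: sum_distrib_left sum_distrib_right mult_ac)
      also have "\<dots> \<in> zspan V"
        by (intro zspan_of_int_mult zspan_sum VI v) auto
      finally show ?thesis .
    qed
  qed
  then have "of_int (c * a) * \<tau> \<in> zstab V"
    using zstab_mult[OF zstab_of_int[OF V, of c]] by (simp add: mult.assoc)
  moreover have "of_int (c * a) * t \<in> zstab V" if "t \<in> T" for t
    using zstab_mult[OF zstab_of_int[OF V, of a] lift[of "of_int c * t"]] W that by (simp add: mult_ac)
  moreover have "c * a \<noteq> 0" using W q by (simp add: a_def)
  ultimately show ?case using V \<open>1 \<in> V\<close> by blast
qed

section \<open>Multipliers as integer matrices\<close>

lemma zstab_matrix:
  assumes b: "bij_betw b {..<D} W" and x: "x \<in> zstab W"
  shows "\<exists>X. \<forall>i<D. x * b i = (\<Sum>k<D. of_int (X i k) * b k)"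
proof -
  have "\<exists>c. x * b i = (\<Sum>k<D. of_int (c k) * b k)" if "i < D" for i
  proof -
    have "b i \<in> W" using b that by (auto simp: bij_betw_def)
    then obtain c where "x * b i = (\<Sum>w\<in>W. of_int (c w) * w)"
      using x unfolding zstab_def zspan_def by blast
    then have "x * b i = (\<Sum>k<D. of_int (c (b k)) * b k)"
      using sum.reindex_bij_betw[OF b, of "\<lambda>w. of_int (c w) * w"] by simp
    then show ?thesis by (rule exI[of _ "\<lambda>k. c (b k)"])
  qed
  then show ?thesis by metis
qed

lemma mult_mat_vec_eq_sum:
  "i < n \<Longrightarrow> vec_index (Matrix.mat n n A *\<^sub>v Matrix.vec n v) i = (\<Sum>k<n. A (i, k) * v k)"
  by (simp add: scalar_prod_def lessThan_atLeast0)

lemma vec_neq_0: "i < n \<Longrightarrow> v i \<noteq> 0 \<Longrightarrow> Matrix.vec n v \<noteq> 0\<^sub>v n"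
  by (metis index_vec index_zero_vec(1))

text \<open>The vector listing \<open>W\<close>, nonzero because of \<open>w\<close>, is an
  eigenvector with eigenvalue \<open>x\<close> of an integer matrix, whose characteristic polynomial
  is monic.\<close>

lemma zstab_imp_algebraic:
  assumes W: "finite W" "w \<in> W" "w \<noteq> 0" and x: "x \<in> zstab W"
  shows "algebraic x"
proof -
  define D where "D = card W"
  obtain b where b: "bij_betw b {..<D} W"
    using ex_bij_betw_nat_finite[OF W(1)] by (auto simp: D_def lessThan_atLeast0)
  obtain X where X: "\<forall>i<D. x * b i = (\<Sum>k<D. of_int (X i k) * b k)"
    using zstab_matrix[OF b x] by blast
  define A where "A = Matrix.mat D D (\<lambda>(i, k). X i k)"
  have A: "A \<in> carrier_mat D D" by (simp add: A_def)
  have CA: "map_mat complex_of_int A = Matrix.mat D D (\<lambda>(i, k). of_int (X i k))"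
    by (rule eq_matI) (auto simp: A_def)
  obtain i where i: "i < D" "b i = w" using b W by (auto simp: bij_betw_def)
  have "Matrix.vec D b \<noteq> 0\<^sub>v D"
    using i W by (intro vec_neq_0[of i]) auto
  moreover have "map_mat complex_of_int A *\<^sub>v Matrix.vec D b = x \<cdot>\<^sub>v Matrix.vec D b"
    unfolding CA
  proof (rule eq_vecI)
    fix i assume "i < dim_vec (x \<cdot>\<^sub>v Matrix.vec D b)"
    then have "i < D" by simp
    then show "vec_index (Matrix.mat D D (\<lambda>(i, k). of_int (X i k)) *\<^sub>v Matrix.vec D b) i =
                 vec_index (x \<cdot>\<^sub>v Matrix.vec D b) i"
      using X by (simp only: mult_mat_vec_eq_sum) simp
  qed simp
  ultimately have "eigenvalue (map_mat complex_of_int A) x"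
    unfolding eigenvalue_def eigenvector_def using A
    by (intro exI[of _ "Matrix.vec D b"]) auto
  then have "poly (cpoly (char_poly A)) x = 0"
    using A by (simp add: eigenvalue_root_char_poly[of _ D] of_int_hom.char_poly_hom[OF A])
  moreover have "char_poly A \<noteq> 0"
    using degree_monic_char_poly[OF A] by auto
  ultimately show ?thesis
    by (intro algebraicI[of "cpoly (char_poly A)"]) auto
qed

text \<open>Replacing each \<open>d j\<close> by its matrix turns the relation into a matrix
  \<open>A\<close> of integer polynomials. At \<open>\<eta>\<close> it annihilates the vector
  listing \<open>W\<close>, and at \<open>0\<close> it is \<open>N\<close> times the identity, so
  its determinant serves as \<open>F\<close>.\<close>

lemma zstab_relation_imp_int_poly:
  assumes W: "finite W" "w \<in> W" "w \<noteq> 0" and d: "\<And>j. j < n \<Longrightarrow> d j \<in> zstab W"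
    and d0: "d 0 = of_int N" and n: "n > 0" and rel: "(\<Sum>j<n. d j * \<eta> ^ j) = 0"
  shows "\<exists>F. poly (cpoly F) \<eta> = 0 \<and> Polynomial.coeff F 0 = N ^ card W"
proof -
  define D where "D = card W"
  obtain b where b: "bij_betw b {..<D} W"
    using ex_bij_betw_nat_finite[OF W(1)] by (auto simp: D_def lessThan_atLeast0)
  have "\<forall>j. j < n \<longrightarrow> (\<exists>X. \<forall>i<D. d j * b i = (\<Sum>k<D. of_int (X i k) * b k))"
    using zstab_matrix[OF b d] by blast
  then obtain Y where Y: "\<And>j i. j < n \<Longrightarrow> i < D \<Longrightarrow> d j * b i = (\<Sum>k<D. of_int (Y j i k) * b k)"
    by metis
  \<comment> \<open>\<open>W\<close> may be linearly dependent over the integers, so the matrix of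
    \<open>d 0\<close> is a choice; taking \<open>N\<close> times the identity fixes the constant
    coefficient of the determinant.\<close>
  define X where "X j i k = (if j = 0 then if i = k then N else 0 else Y j i k)" for j i k
  have X: "d j * b i = (\<Sum>k<D. of_int (X j i k) * b k)" if "j < n" "i < D" for j i
  proof (cases "j = 0")
    case True
    have "(\<Sum>k<D. of_int (X j i k) * b k) = (\<Sum>k<D. if k = i then of_int N * b k else 0)"
      by (intro sum.cong) (auto simp: X_def True)
    then show ?thesis using that True by (simp add: d0)
  qed (use that Y in \<open>simp add: X_def\<close>)
  define A where "A = Matrix.mat D D (\<lambda>(i, k). \<Sum>j<n. Polynomial.monom (X j i k) j)"
  have A: "A \<in> carrier_mat D D" by (simp add: A_def)
  define F where "F = Determinant.det A"
  interpret ev: comm_ring_hom "\<lambda>p. poly (cpoly p) \<eta>"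
    by unfold_locales (simp_all add: hom_distribs)
  have ev0: "comm_ring_hom (\<lambda>p::int poly. poly p 0)"
    by unfold_locales simp_all
  have evA: "map_mat (\<lambda>p. poly (cpoly p) \<eta>) A =
               Matrix.mat D D (\<lambda>(i, k). \<Sum>j<n. of_int (X j i k) * \<eta> ^ j)"
    by (rule eq_matI) (auto simp: A_def ev.hom_sum poly_monom)
  obtain i where i: "i < D" "b i = w" using b W by (auto simp: bij_betw_def)
  have nz: "Matrix.vec D b \<noteq> 0\<^sub>v D"
    using i W by (intro vec_neq_0[of i]) auto
  have "map_mat (\<lambda>p. poly (cpoly p) \<eta>) A *\<^sub>v Matrix.vec D b = 0\<^sub>v D"
    unfolding evA
  proof (rule eq_vecI)
    fix i assume "i < dim_vec (0\<^sub>v D)"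
    then have i: "i < D" by simp
    have "(\<Sum>k<D. (\<Sum>j<n. of_int (X j i k) * \<eta> ^ j) * b k) = (\<Sum>k<D. \<Sum>j<n. of_int (X j i k) * b k * \<eta> ^ j)"
      by (simp add: sum_distrib_right sum_distrib_left mult_ac)
    also have "\<dots> = (\<Sum>j<n. \<Sum>k<D. of_int (X j i k) * b k * \<eta> ^ j)" by (rule sum.swap)
    also have "\<dots> = (\<Sum>j<n. d j * b i * \<eta> ^ j)"
      by (intro sum.cong refl) (simp add: X i sum_distrib_right)
    also have "\<dots> = (\<Sum>j<n. d j * \<eta> ^ j) * b i"
      by (simp add: sum_distrib_right sum_distrib_left mult_ac)
    finally show "vec_index (Matrix.mat D D (\<lambda>(i, k). \<Sum>j<n. of_int (X j i k) * \<eta> ^ j) *\<^sub>v Matrix.vec D b) i =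
        vec_index (0\<^sub>v D) i"
      using i rel by (simp only: mult_mat_vec_eq_sum) simp
  qed simp
  then have "Determinant.det (map_mat (\<lambda>p. poly (cpoly p) \<eta>) A) = 0"
    using nz A by (subst det_0_iff_vec_prod_zero[of _ D]) (auto intro!: exI[of _ "Matrix.vec D b"])
  then have "poly (cpoly F) \<eta> = 0" by (simp add: F_def)
  moreover have "map_mat (\<lambda>p. poly p 0) A = N \<cdot>\<^sub>m 1\<^sub>m D"
  proof (rule eq_matI)
    fix i k assume "i < dim_row (N \<cdot>\<^sub>m 1\<^sub>m D)" "k < dim_col (N \<cdot>\<^sub>m 1\<^sub>m D)"
    then have ik: "i < D" "k < D" by auto
    have "poly (\<Sum>j<n. Polynomial.monom (X j i k) j) 0 = (\<Sum>j<n. if j = 0 then X 0 i k else 0)"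
      unfolding poly_sum poly_monom power_0_left by (intro sum.cong refl) simp
    also have "\<dots> = X 0 i k" using n by simp
    finally show "map_mat (\<lambda>p. poly p 0) A $$ (i, k) = (N \<cdot>\<^sub>m 1\<^sub>m D) $$ (i, k)"
      using ik by (simp add: A_def X_def)
  qed (auto simp: A_def)
  then have "poly F 0 = N ^ D"
    by (simp add: F_def flip: comm_ring_hom.hom_det[OF ev0])
  then have "Polynomial.coeff F 0 = N ^ D" by (simp add: poly_0_coeff_0)
  ultimately show ?thesis by (auto simp: D_def)
qed

text \<open>If the first digits differ, the determinant argument yields a multiple of
  \<open>f\<close> whose constant coefficient is a nonzero integer bounded in terms of
  \<open>T\<close> alone. Hence \<open>C\<close> depends on neither \<open>\<eta>\<close> nor
  \<open>n\<close>.\<close>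

lemma digits_determined_by_constant_coeff:
  assumes T: "finite T" "\<And>t. t \<in> T \<Longrightarrow> algebraic t"
  shows "\<exists>C::real. \<forall>\<eta> f n \<omega> \<omega>'. is_int_minpoly \<eta> f \<and> C < \<bar>Polynomial.coeff f 0\<bar> \<and> 0 < n \<and>
           (\<forall>j<n. \<omega> j \<in> T \<and> \<omega>' j \<in> T) \<and> (\<Sum>j<n. (\<omega> j - \<omega>' j) * \<eta> ^ j) = 0 \<longrightarrow> \<omega> 0 = \<omega>' 0"
proof -
  obtain W c where W: "finite W" "1 \<in> W" "c \<noteq> 0" "\<forall>t\<in>T. of_int c * t \<in> zstab W"
    using ex_zstab[OF T] by blast
  have stab: "of_int c * (x - y) \<in> zstab W" if "x \<in> T" "y \<in> T" for x y
    using zstab_diff[OF W(1)] W(4) that by (simp add: right_diff_distrib)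
  \<comment> \<open>For an annihilating polynomial \<open>pCons a q\<close> of the scaled difference
    \<open>\<delta>\<close> with \<open>a \<noteq> 0\<close>, the multiplier
    \<open>poly (cpoly q) \<delta>\<close> takes \<open>\<delta>\<close> to
    \<open>- a\<close>.\<close>
  have "\<exists>N e. N \<noteq> 0 \<and> e \<in> zstab W \<and> e * (of_int c * (x - y)) = of_int N"
    if "x \<in> T" "y \<in> T" "x \<noteq> y" for x y
  proof -
    define \<delta> where "\<delta> = of_int c * (x - y)"
    have stab\<delta>: "\<delta> \<in> zstab W" unfolding \<delta>_def by (rule stab[OF that(1,2)])
    have "algebraic \<delta>" using zstab_imp_algebraic[OF W(1,2) _ stab\<delta>] by simp
    moreover have "\<delta> \<noteq> 0" using that W by (simp add: \<delta>_def)
    ultimately obtain p where p: "Polynomial.coeff p 0 \<noteq> 0" "poly (cpoly p) \<delta> = 0"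
      by (rule algebraicE'_nonzero)
    obtain a q where q: "p = pCons a q" by (rule pCons_cases)
    have "poly (cpoly q) \<delta> * \<delta> = of_int (- a)"
      using p by (simp add: q map_poly_pCons mult.commute eq_neg_iff_add_eq_0 add.commute)
    moreover have "poly (cpoly q) \<delta> \<in> zstab W"
      by (intro zstab_cpoly stab\<delta> W)
    moreover have "- a \<noteq> 0" using p(1) by (simp add: q)
    ultimately show ?thesis unfolding \<delta>_def by blast
  qed
  then obtain N e where Ne: "\<And>x y. x \<in> T \<Longrightarrow> y \<in> T \<Longrightarrow> x \<noteq> y \<Longrightarrow>
      N x y \<noteq> 0 \<and> e x y \<in> zstab W \<and> e x y * (of_int c * (x - y)) = of_int (N x y)"
    by metis
  \<comment> \<open>The sum serves as a bound for each of its nonnegative terms.\<close>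
  define C where "C = (\<Sum>(x, y)\<in>T \<times> T. \<bar>N x y\<bar> ^ card W)"
  have "\<omega> 0 = \<omega>' 0" if f: "is_int_minpoly \<eta> f" and C: "real_of_int C < \<bar>Polynomial.coeff f 0\<bar>" and n: "0 < n"
    and mem: "\<forall>j<n. \<omega> j \<in> T \<and> \<omega>' j \<in> T" and rel: "(\<Sum>j<n. (\<omega> j - \<omega>' j) * \<eta> ^ j) = 0"
    for \<eta> f n \<omega> \<omega>'
  proof (rule ccontr)
    assume neq: "\<omega> 0 \<noteq> \<omega>' 0"
    let ?N = "N (\<omega> 0) (\<omega>' 0)" and ?e = "e (\<omega> 0) (\<omega>' 0)"
    have T0: "\<omega> 0 \<in> T" "\<omega>' 0 \<in> T" using mem n by auto
    define d where "d j = ?e * (of_int c * (\<omega> j - \<omega>' j))" for j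
    have "d j \<in> zstab W" if "j < n" for j
      unfolding d_def using mem that Ne[OF T0 neq] by (intro zstab_mult[of ?e] stab) auto
    moreover have "d 0 = of_int ?N" using Ne[OF T0 neq] by (simp add: d_def)
    moreover have "(\<Sum>j<n. d j * \<eta> ^ j) = ?e * of_int c * (\<Sum>j<n. (\<omega> j - \<omega>' j) * \<eta> ^ j)"
      by (simp add: d_def sum_distrib_left mult_ac)
    then have "(\<Sum>j<n. d j * \<eta> ^ j) = 0" by (simp add: rel)
    ultimately obtain F where F: "poly (cpoly F) \<eta> = 0" "Polynomial.coeff F 0 = ?N ^ card W"
      using zstab_relation_imp_int_poly[OF W(1,2), of n d ?N \<eta>] n by auto
    obtain h where "F = f * h" using is_int_minpoly_dvd[OF f F(1)] by (elim dvdE)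
    then have "Polynomial.coeff f 0 dvd ?N ^ card W"
      using F(2) by (metis coeff_mult_0 dvd_triv_left)
    then have "\<bar>Polynomial.coeff f 0\<bar> \<le> \<bar>?N ^ card W\<bar>"
      using Ne[OF T0 neq] by (intro dvd_imp_le_int) auto
    also have "\<dots> = (\<lambda>(x, y). \<bar>N x y\<bar> ^ card W) (\<omega> 0, \<omega>' 0)" by (simp add: power_abs)
    also have "\<dots> \<le> C"
      unfolding C_def using T T0 by (intro member_le_sum) auto
    finally show False using C by linarith
  qed
  then show ?thesis by (intro exI[of _ "real_of_int C"]) blast
qed

section \<open>Blaschke products\<close>

text \<open>With \<open>w\<close> read as a power series, \<open>u\<close> and \<open>v\<close> list
  the coefficients of \<open>(1 - a * z) * w\<close> and \<open>(z - cnj a) * w\<close>, so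
  \<open>v\<close> arises from \<open>u\<close> by one Blaschke factor. The difference of the
  partial sums telescopes, so no boundary values are involved.\<close>

lemma blaschke_factor_norm_le:
  fixes w :: "nat \<Rightarrow> complex" and a :: complex
  assumes a: "cmod a \<le> 1"
  defines "u \<equiv> \<lambda>j. w j - a * (if j = 0 then 0 else w (j - 1))"
    and "v \<equiv> \<lambda>j. (if j = 0 then 0 else w (j - 1)) - cnj a * w j"
  shows "(\<Sum>j\<le>J. (cmod (v j))\<^sup>2) \<le> (\<Sum>j\<le>J. (cmod (u j))\<^sup>2)"
proof -
  have key: "(cmod (y - cnj a * x))\<^sup>2 - (cmod (x - a * y))\<^sup>2 =
          (1 - (cmod a)\<^sup>2) * ((cmod y)\<^sup>2 - (cmod x)\<^sup>2)" for x y
    unfolding cmod_power2 by (simp add: power2_eq_square algebra_simps)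
  have "(\<Sum>j\<le>J. (cmod (v j))\<^sup>2) - (\<Sum>j\<le>J. (cmod (u j))\<^sup>2) = - (1 - (cmod a)\<^sup>2) * (cmod (w J))\<^sup>2"
  proof (induction J)
    case 0
    show ?case using key[of 0 "w 0"] by (simp add: u_def v_def algebra_simps)
  next
    case (Suc J)
    show ?case using Suc key[of "w J" "w (Suc J)"] by (simp add: u_def v_def algebra_simps)
  qed
  also have "\<dots> \<le> 0"
    using a by (intro mult_nonpos_nonneg) (auto simp: abs_square_le_1)
  finally show ?thesis by simp
qed

text \<open>The sequence \<open>v\<close> lists the Taylor coefficients of the Blaschke product
  \<open>\<Prod>a\<in>A. (z - cnj a) / (1 - a * z)\<close>. The expansion into geometric sequences is its partial
  fraction decomposition, where \<open>\<Prod>a\<in>A. - (1 / a)\<close> is its value at infinity.\<close>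

lemma blaschke_sequence:
  fixes A :: "complex set"
  assumes "finite A" "\<And>a. a \<in> A \<Longrightarrow> 0 < cmod a \<and> cmod a < 1"
  shows "\<exists>v \<alpha>. (\<forall>J. (\<Sum>j\<le>J. (cmod (v j))\<^sup>2) \<le> 1) \<and> v 0 = (\<Prod>a\<in>A. - cnj a) \<and>
           (\<forall>j. v j = (if j = 0 then \<Prod>a\<in>A. - (1 / a) else 0) + (\<Sum>a\<in>A. \<alpha> a * a ^ j))"
  using assms
proof (induction A)
  case empty
  show ?case
    by (rule exI[of _ "\<lambda>j. if j = 0 then 1 else 0"])
       (auto simp: sum.remove[of "{.._}" 0] intro!: exI[of _ "\<lambda>_. 0"])
next
  case (insert a A)
  then obtain u \<alpha> where u: "\<And>J. (\<Sum>j\<le>J. (cmod (u j))\<^sup>2) \<le> 1" "u 0 = (\<Prod>a\<in>A. - cnj a)"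
    "\<And>j. u j = (if j = 0 then \<Prod>a\<in>A. - (1 / a) else 0) + (\<Sum>a\<in>A. \<alpha> a * a ^ j)"
    by blast
  define c where "c = (\<Prod>a\<in>A. - (1 / a))"
  have a: "a \<noteq> 0" "cmod a < 1" using insert.prems by auto
  have A0: "b \<noteq> 0" "b \<noteq> a" if "b \<in> A" for b using insert that by auto
  \<comment> \<open>From \<open>1 / ((1 - b * z) * (1 - a * z)) = (b / (1 - b * z) - a / (1 - a *
    z)) / (b - a)\<close>. The new geometric sequence receives \<open>c\<close> and one term from
    each old one, which gives \<open>\<delta>\<close>.\<close>
  define \<gamma> where "\<gamma> b = \<alpha> b / (b - a)" for b
  define \<delta> where "\<delta> = c - (\<Sum>b\<in>A. \<gamma> b * a)"
  text \<open>The coefficients of \<open>u / (1 - a * z)\<close>.\<close>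
  define w where "w j = (\<Sum>b\<in>A. \<gamma> b * b * b ^ j) + \<delta> * a ^ j" for j
  define v where "v j = (if j = 0 then 0 else w (j - 1)) - cnj a * w j" for j
  have uw: "u j = w j - a * (if j = 0 then 0 else w (j - 1))" for j
  proof (cases j)
    case 0
    have "(\<Sum>b\<in>A. \<gamma> b * b) - (\<Sum>b\<in>A. \<gamma> b * a) = (\<Sum>b\<in>A. \<alpha> b)"
      unfolding sum_subtractf[symmetric]
      by (intro sum.cong refl) (auto simp: \<gamma>_def field_simps dest: A0)
    then show ?thesis using u(3)[of 0] 0 by (simp add: w_def \<delta>_def c_def)
  next
    case (Suc i)
    have "w j - a * w i = (\<Sum>b\<in>A. \<gamma> b * b * b ^ j - a * (\<gamma> b * b * b ^ i))"
      using Suc by (simp add: w_def sum_subtractf sum_distrib_left algebra_simps)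
    also have "\<dots> = (\<Sum>b\<in>A. \<alpha> b * b ^ j)"
    proof (intro sum.cong refl)
      fix b assume "b \<in> A"
      then have "\<gamma> b * (b - a) = \<alpha> b" using A0 by (simp add: \<gamma>_def)
      then show "\<gamma> b * b * b ^ j - a * (\<gamma> b * b * b ^ i) = \<alpha> b * b ^ j"
        using Suc by (simp add: algebra_simps flip: \<open>\<gamma> b * (b - a) = \<alpha> b\<close>)
    qed
    finally show ?thesis using u(3)[of j] Suc by simp
  qed
  have 1: "(\<Sum>j\<le>J. (cmod (v j))\<^sup>2) \<le> 1" for J
    using order_trans[OF blaschke_factor_norm_le[of a w J] u(1)[of J, unfolded uw]] a(2)
    by (simp add: v_def)
  have 2: "v 0 = (\<Prod>a\<in>insert a A. - cnj a)"
    using insert.hyps uw[of 0] u(2) by (simp add: v_def)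
  define \<alpha>' where "\<alpha>' b = (if b = a then \<delta> * (1 / a - cnj a) else \<gamma> b * (1 - cnj a * b))" for b
  have 3: "v j = (if j = 0 then \<Prod>a\<in>insert a A. - (1 / a) else 0) + (\<Sum>b\<in>insert a A. \<alpha>' b * b ^ j)" for j
  proof -
    have sum: "(\<Sum>b\<in>insert a A. \<alpha>' b * b ^ j) =
        \<delta> * (1 / a - cnj a) * a ^ j + (\<Sum>b\<in>A. \<gamma> b * (1 - cnj a * b) * b ^ j)"
    proof -
      have "(\<Sum>b\<in>A. \<alpha>' b * b ^ j) = (\<Sum>b\<in>A. \<gamma> b * (1 - cnj a * b) * b ^ j)"
        using A0 by (intro sum.cong) (auto simp: \<alpha>'_def)
      then show ?thesis using insert.hyps by (simp add: \<alpha>'_def)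
    qed
    show ?thesis
    proof (cases j)
      case 0
      \<comment> \<open>The shifted sequence has no term at \<open>j = 0\<close>, but the geometric
        expression has one, equal to \<open>c / a\<close>; the new constant
        \<open>- (1 / a) * c\<close> cancels it.\<close>
      have "\<delta> / a + (\<Sum>b\<in>A. \<gamma> b) = c / a"
        using a by (simp add: \<delta>_def sum_distrib_right[symmetric] diff_divide_distrib)
      moreover have "(\<Sum>b\<in>A. \<gamma> b * (1 - cnj a * b)) = (\<Sum>b\<in>A. \<gamma> b) - cnj a * (\<Sum>b\<in>A. \<gamma> b * b)"
        by (simp add: right_diff_distrib sum_subtractf sum_distrib_left mult_ac)
      ultimately show ?thesis
        unfolding sum using 0 insert.hyps by (simp add: v_def w_def c_def[symmetric] algebra_simps)
    next
      case (Suc i)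
      have "v j = (\<Sum>b\<in>A. \<gamma> b * b * b ^ i - cnj a * (\<gamma> b * b * b ^ j)) + \<delta> * (a ^ i - cnj a * a ^ j)"
        using Suc by (simp add: v_def w_def sum_subtractf sum_distrib_left algebra_simps)
      also have "a ^ i - cnj a * a ^ j = (1 / a - cnj a) * a ^ j"
        using a Suc by (simp add: field_simps)
      also have "(\<Sum>b\<in>A. \<gamma> b * b * b ^ i - cnj a * (\<gamma> b * b * b ^ j)) =
          (\<Sum>b\<in>A. \<gamma> b * (1 - cnj a * b) * b ^ j)"
        using Suc by (intro sum.cong) (auto simp: algebra_simps)
      finally show ?thesis unfolding sum using Suc by (simp add: mult.assoc)
    qed
  qed
  show ?case using 1 2 3 by blast
qed

section \<open>The separating functional\<close>

lemma is_int_minpoly_coeff_0: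
  assumes f: "is_int_minpoly \<eta> f" and "\<eta> \<noteq> 0"
  shows "Polynomial.coeff f 0 \<noteq> 0"
proof
  assume "Polynomial.coeff f 0 = 0"
  moreover obtain a h where h: "f = pCons a h" by (rule pCons_cases)
  ultimately have f_eq: "f = pCons 0 h" by simp
  then have "h \<noteq> 0" using is_int_minpoly_nonzero[OF f] by auto
  moreover have "poly (cpoly f) \<eta> = 0" using f by (simp add: is_int_minpoly_def)
  then have "poly (cpoly h) \<eta> = 0"
    using \<open>h \<noteq> 0\<close> \<open>\<eta> \<noteq> 0\<close> by (simp add: f_eq map_poly_pCons)
  ultimately have "degree f \<le> degree h" using f unfolding is_int_minpoly_def by blast
  then show False using \<open>h \<noteq> 0\<close> by (simp add: f_eq)
qed

text \<open>The constant coefficient is, up to sign, the leading one times the product of the roots,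
  and \<open>max 1 (cmod a)\<close> is \<open>cmod a\<close> times \<open>g a\<close>. The roots are
  simple, so each inner root enters the product once.\<close>

lemma mahler_measure_eq_constant_coeff:
  assumes f: "is_int_minpoly \<eta> f" and \<eta>: "\<eta> \<noteq> 0"
  shows "mahler_measure f =
           \<bar>Polynomial.coeff f 0\<bar> * (\<Prod>\<beta> | poly (cpoly f) \<beta> = 0 \<and> cmod \<beta> < 1. 1 / cmod \<beta>)"
proof -
  define rs where "rs = complex_roots_int f"
  define g where "g \<beta> = (if cmod \<beta> < 1 then 1 / cmod \<beta> else 1)" for \<beta> :: complex
  have f0: "f \<noteq> 0" using f by (rule is_int_minpoly_nonzero)
  have fac: "cpoly f = Polynomial.smult (lead_coeff f) (\<Prod>a\<leftarrow>rs. [:- a, 1:])"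
    using complex_roots_int(1)[of f] by (simp add: rs_def)
  have roots: "poly (cpoly f) x = 0 \<longleftrightarrow> x \<in> set rs" for x
  proof -
    have "poly (\<Prod>a\<leftarrow>rs. [:- a, 1:]) x = 0 \<longleftrightarrow> x \<in> set rs"
      by (induction rs) auto
    then show ?thesis using f0 by (simp add: fac)
  qed
  have "distinct rs"
  proof (rule ccontr)
    assume "\<not> distinct rs"
    then obtain xs ys zs y where "rs = xs @ [y] @ ys @ [y] @ zs"
      using not_distinct_decomp by blast
    then have "cpoly f = [:- y, 1:] * ([:- y, 1:] *
        Polynomial.smult (lead_coeff f) (\<Prod>a\<leftarrow>xs @ ys @ zs. [:- a, 1:]))"
      unfolding fac by (simp add: mult_ac del: mult_pCons_left mult_pCons_right)
    then obtain h where "cpoly f = [:- y, 1:] * ([:- y, 1:] * h)" by blast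
    then have "poly (cpoly f) y = 0" "poly (pderiv (cpoly f)) y = 0"
      by (simp_all only: pderiv_mult poly_mult poly_add) simp_all
    then show False using is_int_minpoly_root_simple[OF f] by blast
  qed
  have nz: "x \<noteq> 0" if "x \<in> set rs" for x
    using is_int_minpoly_coeff_0[OF f \<eta>] that roots[of x] by (auto simp: poly_0_coeff_0)
  have "of_int (Polynomial.coeff f 0) = of_int (lead_coeff f) * (\<Prod>a\<leftarrow>rs. - a)"
    using arg_cong[OF fac, of "\<lambda>p. poly p 0"]
    by (simp add: poly_0_coeff_0[of f] poly_prod_list o_def)
  then have "cmod (of_int (Polynomial.coeff f 0)) = cmod (of_int (lead_coeff f) * (\<Prod>a\<leftarrow>rs. - a))"
    by simp
  also have "cmod (\<Prod>a\<leftarrow>rs. - a) = (\<Prod>a\<leftarrow>rs. cmod a)"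
    by (induction rs) (auto simp: norm_mult)
  then have "cmod (of_int (lead_coeff f) * (\<Prod>a\<leftarrow>rs. - a)) = \<bar>lead_coeff f\<bar> * (\<Prod>a\<leftarrow>rs. cmod a)"
    by (simp add: norm_mult)
  finally have c0: "\<bar>Polynomial.coeff f 0\<bar> = \<bar>lead_coeff f\<bar> * (\<Prod>a\<leftarrow>rs. cmod a)" by simp
  have "(\<Prod>a\<leftarrow>rs. max 1 (cmod a)) = (\<Prod>a\<leftarrow>rs. cmod a) * (\<Prod>a\<leftarrow>rs. g a)"
    using nz by (induction rs) (auto simp: g_def max_def)
  then have "mahler_measure f = \<bar>Polynomial.coeff f 0\<bar> * (\<Prod>a\<leftarrow>rs. g a)"
    unfolding mahler_measure_def mahler_measure_poly_def c0
    by (simp add: rs_def complex_roots_int_def)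
  also have "(\<Prod>a\<leftarrow>rs. g a) = (\<Prod>a\<in>set rs. g a)"
    using \<open>distinct rs\<close> by (simp add: prod.distinct_set_conv_list)
  also have "\<dots> = (\<Prod>\<beta> | \<beta> \<in> set rs \<and> cmod \<beta> < 1. 1 / cmod \<beta>)"
    by (simp add: g_def prod.inter_filter)
  finally show ?thesis by (simp add: roots)
qed

definition digit_relation :: "complex set \<Rightarrow> complex \<Rightarrow> nat \<Rightarrow> (nat \<Rightarrow> complex) \<Rightarrow> (nat \<Rightarrow> complex) \<Rightarrow> bool" where
  "digit_relation T \<eta> n \<omega> \<omega>' \<longleftrightarrow>
     0 < n \<and> (\<forall>j<n. \<omega> j \<in> T \<and> \<omega>' j \<in> T) \<and> (\<Sum>j<n. (\<omega> j - \<omega>' j) * \<eta> ^ j) = 0"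

lemma (in ring_embedding) hom_digit_relation:
  assumes "digit_relation T \<eta> n \<omega> \<omega>'" "T \<subseteq> R" "\<eta> \<in> R"
  shows "(\<Sum>j<n. (\<phi> (\<omega> j) - \<phi> (\<omega>' j)) * \<phi> \<eta> ^ j) = 0"
proof -
  have mem: "\<omega> j \<in> R" "\<omega>' j \<in> R" if "j < n" for j
    using assms that by (auto simp: digit_relation_def)
  have "\<phi> (\<Sum>j<n. (\<omega> j - \<omega>' j) * \<eta> ^ j) = (\<Sum>j<n. (\<phi> (\<omega> j) - \<phi> (\<omega>' j)) * \<phi> \<eta> ^ j)"
    using assms(3) mem
    by (subst hom_sum) (auto intro!: sum.cong mult_mem diff_mem power_mem simp: hom_mult hom_diff hom_power diff_mem power_mem)
  then show ?thesis using assms(1) by (simp add: digit_relation_def hom_zero)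
qed

text \<open>The functional \<open>b * s (\<omega> 0) + (\<Sum>j=1..<n. v j * s (\<omega> j))\<close> is a combination of the
  conjugates of \<open>\<Sum>j<n. \<omega> j * \<eta> ^ j\<close>, hence a function of that sum; a large \<open>b\<close> makes the leading
  digit stand out against the noise of the other ones.\<close>

definition has_separating_functional :: "complex set \<Rightarrow> real \<Rightarrow> real \<Rightarrow> real \<Rightarrow> complex \<Rightarrow> bool" where
  "has_separating_functional T \<delta> B K \<eta> \<longleftrightarrow>
     (\<exists>s b v. (\<forall>x\<in>T. cmod (s x) \<le> B) \<and> (\<forall>x\<in>T. \<forall>y\<in>T. x \<noteq> y \<longrightarrow> \<delta> \<le> cmod (s x - s y)) \<and>
       K \<le> cmod b \<and> (\<forall>n. (\<Sum>j=1..<n. (cmod (v j))\<^sup>2) \<le> 1) \<and>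
       (\<forall>n \<omega> \<omega>'. digit_relation T \<eta> n \<omega> \<omega>' \<longrightarrow>
          b * (s (\<omega> 0) - s (\<omega>' 0)) + (\<Sum>j=1..<n. v j * (s (\<omega> j) - s (\<omega>' j))) = 0))"

text \<open>The order of quantifiers matters: \<open>\<delta>\<close> and \<open>B\<close> depend on
  \<open>T\<close> alone, so \<open>K\<close> can later be chosen in terms of them. This works
  because \<open>s\<close> takes values in a fixed finite set of roots.\<close>

lemma ex_separating_functional:
  assumes T: "finite T" "\<And>t. t \<in> T \<Longrightarrow> algebraic t"
  shows "\<exists>\<delta> B. 0 < \<delta> \<and> (\<forall>K. \<exists>M. \<forall>\<eta>. algebraic \<eta> \<and> \<eta> \<noteq> 0 \<and> M \<le> algebraic_mahler_measure \<eta> \<longrightarrow>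
    (\<forall>n \<omega> \<omega>'. digit_relation T \<eta> n \<omega> \<omega>' \<longrightarrow> \<omega> 0 = \<omega>' 0) \<or>
    has_separating_functional T \<delta> B K \<eta>)"
proof -
  have "\<forall>t\<in>T. \<exists>q. q \<noteq> 0 \<and> poly (cpoly q) t = 0"
    using T(2) by (meson algebraicE')
  then obtain q where q: "\<And>t. t \<in> T \<Longrightarrow> q t \<noteq> 0 \<and> poly (cpoly (q t)) t = 0" by metis
  define Z where "Z = (\<Union>t\<in>T. {z. poly (cpoly (q t)) z = 0})"
  have Z: "finite Z" unfolding Z_def using T q by (auto intro!: poly_roots_finite)
  define S where "S = (T \<rightarrow>\<^sub>E Z)"
  have S: "finite S" unfolding S_def using T Z by (intro finite_PiE)
  define B where "B = (\<Sum>z\<in>Z. cmod z)"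
  have B: "cmod z \<le> B" if "z \<in> Z" for z
    unfolding B_def using that Z by (intro member_le_sum) auto
  \<comment> \<open>The element \<open>1\<close> keeps the minimum defined when \<open>Z\<close> has
    no two distinct points.\<close>
  define E where "E = insert 1 ((\<lambda>(z, z'). cmod (z - z')) ` {(z, z') \<in> Z \<times> Z. z \<noteq> z'})"
  have E: "finite E" "E \<noteq> {}" "\<And>e. e \<in> E \<Longrightarrow> e > 0"
    unfolding E_def using Z by (auto intro: finite_subset[of _ "Z \<times> Z"])
  define \<delta> where "\<delta> = Min E"
  have \<delta>: "\<delta> > 0" using E by (simp add: \<delta>_def)
  have \<delta>_le: "\<delta> \<le> cmod (z - z')" if "z \<in> Z" "z' \<in> Z" "z \<noteq> z'" for z z'
    unfolding \<delta>_def using that E(1) by (intro Min_le) (auto simp: E_def)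
  obtain C :: real where C: "\<And>\<eta> f n \<omega> \<omega>'. is_int_minpoly \<eta> f \<Longrightarrow> C < \<bar>Polynomial.coeff f 0\<bar> \<Longrightarrow>
      digit_relation T \<eta> n \<omega> \<omega>' \<Longrightarrow> \<omega> 0 = \<omega>' 0"
    using digits_determined_by_constant_coeff[OF T] unfolding digit_relation_def by blast
  show ?thesis
  proof (rule exI[of _ \<delta>], rule exI[of _ B], intro conjI \<delta> allI)
    fix K :: real
    \<comment> \<open>The summand \<open>1\<close> pays for \<open>v 0\<close> in the bound for
      \<open>b\<close>, and \<open>K' > 1\<close> keeps the chosen class of roots from being
      empty.\<close>
    define K' where "K' = max 1 K + 1"
    define M where "M = max 0 C * K' ^ card S + 1"
    have K': "K' > 1" by (simp add: K'_def)
    show "\<exists>M. \<forall>\<eta>. algebraic \<eta> \<and> \<eta> \<noteq> 0 \<and> M \<le> algebraic_mahler_measure \<eta> \<longrightarrow>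
      (\<forall>n \<omega> \<omega>'. digit_relation T \<eta> n \<omega> \<omega>' \<longrightarrow> \<omega> 0 = \<omega>' 0) \<or>
      has_separating_functional T \<delta> B K \<eta>"
    proof (intro exI[of _ M] allI impI, elim conjE)
      fix \<eta> assume \<eta>: "algebraic \<eta>" "\<eta> \<noteq> 0" "M \<le> algebraic_mahler_measure \<eta>"
      define f where "f = int_minpoly \<eta>"
      have f: "is_int_minpoly \<eta> f" unfolding f_def by (rule is_int_minpoly_int_minpoly) fact
      show "(\<forall>n \<omega> \<omega>'. digit_relation T \<eta> n \<omega> \<omega>' \<longrightarrow> \<omega> 0 = \<omega>' 0) \<or>
        has_separating_functional T \<delta> B K \<eta>"
      proof (cases "C < \<bar>Polynomial.coeff f 0\<bar>")
        case True
        then show ?thesis using C[OF f] by blast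
      next
        case False
        define A where "A = {\<beta>. poly (cpoly f) \<beta> = 0 \<and> cmod \<beta> < 1}"
        have A: "finite A"
          unfolding A_def using is_int_minpoly_nonzero[OF f]
          by (intro finite_subset[OF _ poly_roots_finite[of "cpoly f"]]) auto
        have A0: "0 < cmod \<beta>" "cmod \<beta> < 1" if "\<beta> \<in> A" for \<beta>
          using that is_int_minpoly_coeff_0[OF f \<eta>(2)]
          by (auto simp: A_def poly_0_coeff_0)
        have "\<forall>\<beta>\<in>A. \<exists>R \<phi>. ring_embedding R \<phi> \<and> \<eta> \<in> R \<and> \<phi> \<eta> = \<beta> \<and> T \<subseteq> R"
          unfolding A_def using ex_ring_embedding[OF f _ T] by blast
        then obtain R \<phi> where R: "\<And>\<beta>. \<beta> \<in> A \<Longrightarrow>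
            ring_embedding (R \<beta>) (\<phi> \<beta>) \<and> \<eta> \<in> R \<beta> \<and> \<phi> \<beta> \<eta> = \<beta> \<and> T \<subseteq> R \<beta>"
          by metis
        \<comment> \<open>The restriction lies in the finite set \<open>S\<close> of extensional
          functions, and agreement on \<open>T\<close> becomes equality.\<close>
        define \<sigma> where "\<sigma> \<beta> = restrict (\<phi> \<beta>) T" for \<beta>
        have \<sigma>: "\<sigma> \<beta> \<in> S" if "\<beta> \<in> A" for \<beta>
        proof -
          have "poly (cpoly (q t)) (\<phi> \<beta> t) = 0" if "t \<in> T" for t
          proof -
            interpret ring_embedding "R \<beta>" "\<phi> \<beta>" using R[OF \<open>\<beta> \<in> A\<close>] by blast
            have "t \<in> R \<beta>" using R[OF \<open>\<beta> \<in> A\<close>] that by blast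
            from hom_poly[OF this Rpoly_cpoly[of "q t"]] show ?thesis
              using q[OF that] by (simp add: map_poly_hom_cpoly hom_zero)
          qed
          then show ?thesis by (auto simp: \<sigma>_def S_def Z_def)
        qed
        have "M \<le> \<bar>Polynomial.coeff f 0\<bar> * (\<Prod>\<beta>\<in>A. 1 / cmod \<beta>)"
          using \<eta>(3) mahler_measure_eq_constant_coeff[OF f \<eta>(2)]
          by (simp add: algebraic_mahler_measure_def f_def A_def)
        also have "\<dots> \<le> max 0 C * (\<Prod>\<beta>\<in>A. 1 / cmod \<beta>)"
          using False by (intro mult_right_mono prod_nonneg) auto
        finally have "max 0 C * K' ^ card S < max 0 C * (\<Prod>\<beta>\<in>A. 1 / cmod \<beta>)"
          by (simp add: M_def)
        then have big: "K' ^ card S < (\<Prod>\<beta>\<in>A. 1 / cmod \<beta>)"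
          by (rule mult_left_less_imp_less) simp
        have "(\<Prod>\<beta>\<in>A. 1 / cmod \<beta>) = (\<Prod>s\<in>S. \<Prod>\<beta> | \<beta> \<in> A \<and> \<sigma> \<beta> = s. 1 / cmod \<beta>)"
          using A S \<sigma> by (intro prod.group[symmetric]) auto
        \<comment> \<open>Multiplicative pigeonhole principle: if every class product were at most
          \<open>K'\<close>, the whole would be at most \<open>K' ^ card S\<close>.\<close>
        with big have "\<exists>s\<in>S. K' < (\<Prod>\<beta> | \<beta> \<in> A \<and> \<sigma> \<beta> = s. 1 / cmod \<beta>)"
        proof -
          have "(\<Prod>s\<in>S. \<Prod>\<beta> | \<beta> \<in> A \<and> \<sigma> \<beta> = s. 1 / cmod \<beta>) \<le> (\<Prod>s\<in>S. K')"
            if "\<forall>s\<in>S. (\<Prod>\<beta> | \<beta> \<in> A \<and> \<sigma> \<beta> = s. 1 / cmod \<beta>) \<le> K'"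
            using that by (intro prod_mono) (auto intro!: prod_nonneg)
          then show ?thesis
            using big \<open>(\<Prod>\<beta>\<in>A. 1 / cmod \<beta>) = _\<close> by (force simp: not_le[symmetric])
        qed
        then obtain s where s: "s \<in> S" "K' < (\<Prod>\<beta> | \<beta> \<in> A \<and> \<sigma> \<beta> = s. 1 / cmod \<beta>)" by blast
        define G where "G = {\<beta>. \<beta> \<in> A \<and> \<sigma> \<beta> = s}"
        have G: "finite G" "G \<subseteq> A" using A by (auto simp: G_def)
        have \<phi>s: "\<phi> \<beta> t = s t" if "\<beta> \<in> G" "t \<in> T" for \<beta> t
          using that by (auto simp: G_def \<sigma>_def)
        have "G \<noteq> {}" using s(2) K' unfolding G_def[symmetric] by auto
        then obtain \<beta>0 where \<beta>0: "\<beta>0 \<in> G" by blast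
        have sZ: "s x \<in> Z" if "x \<in> T" for x
          using s(1) that by (auto simp: S_def)
        have s_inj: "s x \<noteq> s y" if "x \<in> T" "y \<in> T" "x \<noteq> y" for x y
        proof -
          have "\<beta>0 \<in> A" using \<beta>0 G by blast
          then interpret ring_embedding "R \<beta>0" "\<phi> \<beta>0" using R by blast
          show ?thesis using hom_eq_iff[of x y] R[OF \<open>\<beta>0 \<in> A\<close>] that
            by (auto simp flip: \<phi>s[OF \<beta>0])
        qed
        obtain v \<alpha> where v: "\<And>J. (\<Sum>j\<le>J. (cmod (v j))\<^sup>2) \<le> 1" "v 0 = (\<Prod>a\<in>G. - cnj a)"
          "\<And>j. v j = (if j = 0 then \<Prod>a\<in>G. - (1 / a) else 0) + (\<Sum>a\<in>G. \<alpha> a * a ^ j)"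
          using blaschke_sequence[OF G(1)] A0 G by blast
        \<comment> \<open>This is \<open>v 0\<close> minus the value of the Blaschke product at
          infinity. The latter has modulus above \<open>K'\<close>, while \<open>v 0\<close> has
          modulus at most 1.\<close>
        define b where "b = (\<Sum>a\<in>G. \<alpha> a)"
        have "K \<le> cmod b"
        proof -
          have b_eq: "(\<Prod>a\<in>G. - (1 / a)) = v 0 - b" using v(3)[of 0] by (simp add: b_def)
          have "K' < (\<Prod>a\<in>G. 1 / cmod a)" using s(2) by (simp add: G_def)
          also have "\<dots> = cmod (\<Prod>a\<in>G. - (1 / a))" by (simp add: prod_norm[symmetric] norm_divide)
          also have "\<dots> \<le> cmod (v 0) + cmod b" unfolding b_eq by (rule norm_triangle_ineq4)
          also have "(cmod (v 0))\<^sup>2 \<le> 1" using v(1)[of 0] by simp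
          then have "cmod (v 0) \<le> 1" by (simp add: abs_square_le_1)
          finally show ?thesis by (simp add: K'_def)
        qed
        moreover have "(\<Sum>j=1..<n. (cmod (v j))\<^sup>2) \<le> 1" for n
          by (rule order_trans[OF _ v(1)[of n]]) (intro sum_mono2, auto)
        moreover have "b * (s (\<omega> 0) - s (\<omega>' 0)) + (\<Sum>j=1..<n. v j * (s (\<omega> j) - s (\<omega>' j))) = 0"
          if rel: "digit_relation T \<eta> n \<omega> \<omega>'" for n \<omega> \<omega>'
        proof -
          have n: "n > 0" and mem: "\<And>j. j < n \<Longrightarrow> \<omega> j \<in> T \<and> \<omega>' j \<in> T"
            using rel by (auto simp: digit_relation_def)
          define c where "c j = s (\<omega> j) - s (\<omega>' j)" for j
          have "(\<Sum>j<n. c j * a ^ j) = 0" if "a \<in> G" for a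
          proof -
            have a: "a \<in> A" using that G by blast
            then interpret ring_embedding "R a" "\<phi> a" using R by blast
            have "(\<Sum>j<n. (\<phi> a (\<omega> j) - \<phi> a (\<omega>' j)) * a ^ j) = 0"
              using hom_digit_relation[OF rel] R[OF a] by simp
            also have "(\<Sum>j<n. (\<phi> a (\<omega> j) - \<phi> a (\<omega>' j)) * a ^ j) = (\<Sum>j<n. c j * a ^ j)"
              using mem \<phi>s[OF that] by (intro sum.cong) (auto simp: c_def)
            finally show ?thesis .
          qed
          \<comment> \<open>All embeddings in the class share the differences \<open>c j\<close>, so
            the conjugate relations can be combined with weights \<open>\<alpha> a\<close>. The
            coefficient of \<open>c j\<close> is then \<open>b\<close> at \<open>j = 0\<close> and
            \<open>v j\<close> otherwise.\<close>
          then have "0 = (\<Sum>a\<in>G. \<alpha> a * (\<Sum>j<n. c j * a ^ j))" by simp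
          also have "\<dots> = (\<Sum>a\<in>G. \<Sum>j<n. \<alpha> a * a ^ j * c j)"
            by (simp add: sum_distrib_left mult_ac)
          also have "\<dots> = (\<Sum>j<n. \<Sum>a\<in>G. \<alpha> a * a ^ j * c j)" by (rule sum.swap)
          also have "\<dots> = (\<Sum>j<n. (\<Sum>a\<in>G. \<alpha> a * a ^ j) * c j)" by (simp add: sum_distrib_right)
          also have "{..<n} = insert 0 {1..<n}" using n by auto
          also have "(\<Sum>j\<in>insert 0 {1..<n}. (\<Sum>a\<in>G. \<alpha> a * a ^ j) * c j) =
              b * c 0 + (\<Sum>j=1..<n. (\<Sum>a\<in>G. \<alpha> a * a ^ j) * c j)"
            by (simp add: b_def)
          also have "(\<Sum>j=1..<n. (\<Sum>a\<in>G. \<alpha> a * a ^ j) * c j) = (\<Sum>j=1..<n. v j * c j)"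
            by (intro sum.cong refl) (auto simp: v(3))
          finally show ?thesis by (simp add: c_def)
        qed
        ultimately show ?thesis
          unfolding has_separating_functional_def
          using B sZ \<delta>_le s_inj by (intro disjI2 exI[of _ s] exI[of _ b] exI[of _ v]) auto
      qed
    qed
  qed
qed

section \<open>Recovering the first digit\<close>

text \<open>Fano's inequality for two functions on one probability space: the event \<open>D\<close>
  is passed to its image under the pair, whose complement is no more likely. The bound
  \<open>c \<le> 1\<close> keeps \<open>1 - ln c\<close> nonnegative.\<close>

lemma shannon_entropy_map_pmf_pair_le:
  fixes X :: "'a \<Rightarrow> 'b" and S :: "'a \<Rightarrow> 'c" and c \<kappa> :: real
  assumes fin: "finite (set_pmf P)"
    and det: "\<And>\<omega> \<omega>'. \<omega> \<in> set_pmf P \<inter> D \<Longrightarrow> \<omega>' \<in> set_pmf P \<inter> D \<Longrightarrow> S \<omega> = S \<omega>' \<Longrightarrow> X \<omega> = X \<omega>'"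
    and \<kappa>: "measure_pmf.prob P (- D) \<le> \<kappa>" and c: "0 < c" "c \<le> 1"
  shows "shannon_entropy (map_pmf (\<lambda>\<omega>. (X \<omega>, S \<omega>)) P) \<le>
           shannon_entropy (map_pmf S P) + c * card (X ` set_pmf P) + \<kappa> * (1 - ln c)"
proof -
  let ?Z = "map_pmf (\<lambda>\<omega>. (X \<omega>, S \<omega>)) P"
  let ?E = "(\<lambda>\<omega>. (X \<omega>, S \<omega>)) ` (set_pmf P \<inter> D)"
  have inj: "inj_on snd (set_pmf ?Z \<inter> ?E)"
  proof (rule inj_onI)
    fix z z' assume "z \<in> set_pmf ?Z \<inter> ?E" "z' \<in> set_pmf ?Z \<inter> ?E" and eq: "snd z = snd z'"
    then obtain \<omega> \<omega>' where *: "z = (X \<omega>, S \<omega>)" "\<omega> \<in> set_pmf P \<inter> D" "z' = (X \<omega>', S \<omega>')" "\<omega>' \<in> set_pmf P \<inter> D"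
      by blast
    show "z = z'" using det[OF *(2,4)] eq unfolding *(1,3) by simp
  qed
  have "measure_pmf.prob ?Z (- ?E) \<le> measure_pmf.prob P (- D)"
    unfolding measure_map_pmf
    by (rule measure_pmf.finite_measure_mono_AE) (auto simp: AE_measure_pmf_iff)
  with \<kappa> have "measure_pmf.prob ?Z (- ?E) * (1 - ln c) \<le> \<kappa> * (1 - ln c)"
    using c by (intro mult_right_mono) (auto intro: order_trans[OF ln_le_minus_one])
  then show ?thesis
    using shannon_entropy_fano[OF _ inj c(1)] fin
    by (simp add: map_pmf_comp image_image algebra_simps)
qed

text \<open>As \<open>\<eta> \<noteq> 0\<close>, the pair \<open>(x, x + \<eta> * y)\<close>
  determines \<open>(x, y)\<close>, so its entropy is that of an independent pair.\<close>

lemma shannon_entropy_first_digit_and_sum: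
  assumes fin: "finite (set_pmf \<nu>)" and \<eta>: "\<eta> \<noteq> 0"
  shows "shannon_entropy (map_pmf (\<lambda>\<omega>. (\<omega> 0, \<Sum>j<Suc n. \<omega> j * \<eta> ^ j)) (Pi_pmf {..<Suc n} 0 (\<lambda>_. \<nu>))) =
           shannon_entropy \<nu> + shannon_entropy (partial_sum_law \<eta> \<nu> n)"
proof -
  have eq: "map_pmf (\<lambda>\<omega>. (\<omega> 0, \<Sum>j<Suc n. \<omega> j * \<eta> ^ j)) (Pi_pmf {..<Suc n} 0 (\<lambda>_. \<nu>)) =
        map_pmf (\<lambda>(x, y). (x, x + \<eta> * y)) (pair_pmf \<nu> (partial_sum_law \<eta> \<nu> n))"
    unfolding partial_sum_law_def Pi_pmf_lessThan_Suc pair_map_pmf2 map_pmf_comp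
    by (intro map_pmf_cong refl)
       (auto simp: sum.lessThan_Suc_shift sum_distrib_left mult_ac simp del: sum.lessThan_Suc)
  show ?thesis
    unfolding eq using \<eta> fin
    by (subst shannon_entropy_map_pmf_inj_on)
       (auto simp: inj_on_def finite_set_partial_sum_law shannon_entropy_pair_pmf)
qed

text \<open>The entropy of the first digit together with the sum is computed exactly on one side and
  bounded by Fano's inequality on the other.\<close>

lemma shannon_entropy_partial_sum_law_Suc_ge:
  fixes c \<kappa> :: real
  assumes fin: "finite (set_pmf \<nu>)" and \<eta>: "\<eta> \<noteq> 0" and c: "0 < c" "c \<le> 1"
    and \<kappa>: "measure_pmf.prob (Pi_pmf {..<Suc n} 0 (\<lambda>_. \<nu>)) (- D) \<le> \<kappa>"
    and det: "\<And>\<omega> \<omega>'. \<omega> \<in> D \<Longrightarrow> \<omega>' \<in> D \<Longrightarrow> digit_relation (set_pmf \<nu>) \<eta> (Suc n) \<omega> \<omega>' \<Longrightarrow> \<omega> 0 = \<omega>' 0"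
  shows "shannon_entropy (partial_sum_law \<eta> \<nu> n) + shannon_entropy \<nu> \<le>
           shannon_entropy (partial_sum_law \<eta> \<nu> (Suc n)) + c * card (set_pmf \<nu>) + \<kappa> * (1 - ln c)"
proof -
  let ?P = "Pi_pmf {..<Suc n} 0 (\<lambda>_. \<nu>)"
  let ?S = "\<lambda>\<omega>. \<Sum>j<Suc n. \<omega> j * \<eta> ^ j"
  have finP: "finite (set_pmf ?P)" by (intro finite_set_Pi_pmf fin) auto
  have mem: "\<omega> j \<in> set_pmf \<nu>" if "\<omega> \<in> set_pmf ?P" "j < Suc n" for \<omega> j
    using that set_Pi_pmf_subset'[of "{..<Suc n}" 0 "\<lambda>_. \<nu>"] by (auto simp: PiE_dflt_def)
  have rel: "digit_relation (set_pmf \<nu>) \<eta> (Suc n) \<omega> \<omega>'"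
    if "\<omega> \<in> set_pmf ?P" "\<omega>' \<in> set_pmf ?P" "?S \<omega> = ?S \<omega>'" for \<omega> \<omega>'
    using that mem
    by (auto simp: digit_relation_def left_diff_distrib sum_subtractf simp del: sum.lessThan_Suc)
  have "shannon_entropy \<nu> + shannon_entropy (partial_sum_law \<eta> \<nu> n) =
          shannon_entropy (map_pmf (\<lambda>\<omega>. (\<omega> 0, ?S \<omega>)) ?P)"
    by (rule shannon_entropy_first_digit_and_sum[OF fin \<eta>, symmetric])
  also have "\<dots> \<le> shannon_entropy (map_pmf ?S ?P) + c * card ((\<lambda>\<omega>. \<omega> 0) ` set_pmf ?P) + \<kappa> * (1 - ln c)"
    by (rule shannon_entropy_map_pmf_pair_le[OF finP _ \<kappa> c]) (use det rel in blast)
  also have "card ((\<lambda>\<omega>. \<omega> 0) ` set_pmf ?P) \<le> card (set_pmf \<nu>)"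
    using mem by (intro card_mono fin) auto
  finally show ?thesis
    using c by (simp add: partial_sum_law_def mult_left_mono algebra_simps del: sum.lessThan_Suc)
qed

section \<open>Support and entropy of the digit law\<close>

lemma pmf_of_list_wf_atomic_law:
  assumes "\<forall>j\<in>{1..m}. 0 \<le> p j" "(\<Sum>j = 1..m. p j) = 1"
  shows "pmf_of_list_wf (map (\<lambda>j. (t j, p j)) [1..<Suc m])"
  using assms
  by (intro pmf_of_list_wfI)
     (auto simp: o_def sum_list_distinct_conv_sum_set atLeastLessThanSuc_atLeastAtMost simp del: upt_Suc)

lemma set_pmf_atomic_law:
  assumes "\<forall>j\<in>{1..m}. 0 \<le> p j" "(\<Sum>j = 1..m. p j) = 1"
  shows "set_pmf (atomic_law m p t) \<subseteq> t ` {1..m}"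
  unfolding atomic_law_def
  using set_pmf_of_list[OF pmf_of_list_wf_atomic_law[OF assms, of t]]
  by (force simp: image_image simp del: upt_Suc)

text \<open>Injectivity of \<open>t\<close> prevents weights from merging. Atoms of weight zero lie
  outside the support and add only \<open>0 * ln 0 = 0\<close>.\<close>

lemma shannon_entropy_atomic_law:
  assumes p: "\<forall>j\<in>{1..m}. 0 \<le> p j" "(\<Sum>j = 1..m. p j) = 1" and inj: "inj_on t {1..m}"
  shows "shannon_entropy (atomic_law m p t) = vector_entropy m p"
proof -
  let ?\<nu> = "atomic_law m p t"
  have pmf: "pmf ?\<nu> (t j) = p j" if j: "j \<in> {1..m}" for j
  proof -
    have "pmf ?\<nu> (t j) = (\<Sum>i\<leftarrow>filter (\<lambda>i. t i = t j) [1..<Suc m]. p i)"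
      unfolding atomic_law_def pmf_pmf_of_list[OF pmf_of_list_wf_atomic_law[OF p]]
      by (simp add: filter_map o_def del: upt_Suc)
    also have "\<dots> = (\<Sum>i | i \<in> {1..m} \<and> t i = t j. p i)"
      by (subst sum_list_distinct_conv_sum_set)
         (auto intro!: sum.cong simp del: upt_Suc simp: less_Suc_eq_le)
    also have "{i. i \<in> {1..m} \<and> t i = t j} = {j}"
      using inj j unfolding inj_on_def by blast
    finally show ?thesis by simp
  qed
  have fin: "finite (set_pmf ?\<nu>)"
    using set_pmf_atomic_law[OF p] by (rule finite_subset) simp
  have "shannon_entropy ?\<nu> = (\<Sum>x\<in>t ` {1..m}. pmf ?\<nu> x * - ln (pmf ?\<nu> x))"
    unfolding shannon_entropy_eq_sum[OF fin]
    by (intro sum.mono_neutral_left set_pmf_atomic_law[OF p]) (auto simp: set_pmf_eq)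
  also have "\<dots> = (\<Sum>j = 1..m. p j * - ln (p j))"
    using inj by (simp add: sum.reindex pmf)
  finally show ?thesis by (simp add: vector_entropy_def sum_negf)
qed

theorem theorem6p1:
  fixes m :: nat and t :: "nat \<Rightarrow> complex" and p :: "nat \<Rightarrow> real" and h :: real
  assumes "\<forall>j\<in>{1..m}. algebraic (t j)"
    and "inj_on t {1..m}"
    and "\<forall>j\<in>{1..m}. 0 \<le> p j"
    and "(\<Sum>j = 1..m. p j) = 1"
    and "0 < h" and "h < vector_entropy m p"
  shows "\<exists>M>0. \<forall>\<eta>::complex.
           algebraic \<eta> \<and> 0 < cmod \<eta> \<and> cmod \<eta> < 1 \<and> algebraic_mahler_measure \<eta> \<ge> M \<longrightarrow>
           garsia_entropy \<eta> (atomic_law m p t) \<ge> h"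
proof -
  define \<nu> where "\<nu> = atomic_law m p t"
  define T where "T = set_pmf \<nu>"
  have T_sub: "T \<subseteq> t ` {1..m}"
    unfolding T_def \<nu>_def by (rule set_pmf_atomic_law) fact+
  then have T: "finite T" by (rule finite_subset) simp
  have alg: "\<And>x. x \<in> T \<Longrightarrow> algebraic x" using T_sub assms(1) by auto
  have H\<nu>: "shannon_entropy \<nu> = vector_entropy m p"
    unfolding \<nu>_def by (rule shannon_entropy_atomic_law) fact+
  have T0: "card T > 0" using T by (simp add: T_def card_gt_0_iff set_pmf_not_empty)
  define \<epsilon> where "\<epsilon> = vector_entropy m p - h"
  have \<epsilon>: "\<epsilon> > 0" using assms by (simp add: \<epsilon>_def)
  \<comment> \<open>The admissible loss \<open>\<epsilon>\<close> is split in halves: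
    \<open>c\<close> settles the cardinality term of Fano's bound, and \<open>\<kappa>\<close> below
    settles the error probability term.\<close>
  define c where "c = min 1 (\<epsilon> / (2 * card T))"
  have c: "0 < c" "c \<le> 1" "c * card T \<le> \<epsilon> / 2"
    using \<epsilon> T0 by (auto simp: c_def min_def field_simps)
  define L where "L = 1 - ln c"
  have L: "L > 0" unfolding L_def using ln_le_minus_one[of c] c by linarith
  define \<kappa> where "\<kappa> = \<epsilon> / (2 * L)"
  have \<kappa>: "\<kappa> > 0" "\<kappa> * L = \<epsilon> / 2"
    using \<epsilon> L by (auto simp: \<kappa>_def)
  obtain \<delta> B where \<delta>: "0 < \<delta>" and sep: "\<And>K. \<exists>M. \<forall>\<eta>. algebraic \<eta> \<and> \<eta> \<noteq> 0 \<and> M \<le> algebraic_mahler_measure \<eta> \<longrightarrow>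
    (\<forall>n \<omega> \<omega>'. digit_relation T \<eta> n \<omega> \<omega>' \<longrightarrow> \<omega> 0 = \<omega>' 0) \<or>
    has_separating_functional T \<delta> B K \<eta>"
    using ex_separating_functional[OF T alg] by blast
  \<comment> \<open>With \<open>r = cmod b * \<delta> / 2\<close> this makes Chebyshev's bound
    \<open>(2 * B / r)\<^sup>2\<close> at most \<open>\<kappa>\<close>; the maximum keeps
    \<open>b\<close> away from zero.\<close>
  define K where "K = max 1 (4 * B / (\<delta> * sqrt \<kappa>))"
  obtain M where M: "\<And>\<eta>. algebraic \<eta> \<Longrightarrow> \<eta> \<noteq> 0 \<Longrightarrow> M \<le> algebraic_mahler_measure \<eta> \<Longrightarrow>
    (\<forall>n \<omega> \<omega>'. digit_relation T \<eta> n \<omega> \<omega>' \<longrightarrow> \<omega> 0 = \<omega>' 0) \<or>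
    has_separating_functional T \<delta> B K \<eta>"
    using sep[of K] by blast
  have "garsia_entropy \<eta> \<nu> \<ge> h" if \<eta>: "algebraic \<eta>" "\<eta> \<noteq> 0" "M \<le> algebraic_mahler_measure \<eta>" for \<eta>
  proof (rule garsia_entropy_ge)
    show fin: "finite (set_pmf \<nu>)" using T by (simp add: T_def)
    fix n
    let ?P = "Pi_pmf {..<Suc n} 0 (\<lambda>_. \<nu>)"
    \<comment> \<open>If the sum determines the first digit, \<open>D\<close> is everything;
      otherwise it is the event that the noise \<open>Y\<close> stays below
      \<open>r\<close>.\<close>
    have "\<exists>D. measure_pmf.prob ?P (- D) \<le> \<kappa> \<and>
      (\<forall>\<omega>\<in>D. \<forall>\<omega>'\<in>D. digit_relation T \<eta> (Suc n) \<omega> \<omega>' \<longrightarrow> \<omega> 0 = \<omega>' 0)"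
      using M[OF \<eta>] unfolding has_separating_functional_def
    proof (elim disjE exE conjE)
      assume "\<forall>n \<omega> \<omega>'. digit_relation T \<eta> n \<omega> \<omega>' \<longrightarrow> \<omega> 0 = \<omega>' 0"
      then show ?thesis using \<kappa> by (intro exI[of _ UNIV]) auto
    next
      fix s b v
      assume s: "\<forall>x\<in>T. cmod (s x) \<le> B" "\<forall>x\<in>T. \<forall>y\<in>T. x \<noteq> y \<longrightarrow> \<delta> \<le> cmod (s x - s y)"
        and b: "K \<le> cmod b" and v: "\<forall>n. (\<Sum>j=1..<n. (cmod (v j))\<^sup>2) \<le> 1"
        and rel: "\<forall>n \<omega> \<omega>'. digit_relation T \<eta> n \<omega> \<omega>' \<longrightarrow>
          b * (s (\<omega> 0) - s (\<omega>' 0)) + (\<Sum>j=1..<n. v j * (s (\<omega> j) - s (\<omega>' j))) = 0"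
      define \<mu> where "\<mu> = measure_pmf.expectation \<nu> s"
      \<comment> \<open>Half the least distance between the values of \<open>b * s\<close> at
        different digits, so two noise terms below \<open>r\<close> cannot bridge it.\<close>
      define r where "r = cmod b * \<delta> / 2"
      define Y where "Y \<omega> = (\<Sum>j=1..<Suc n. v j * (s (\<omega> j) - \<mu>))" for \<omega> :: "nat \<Rightarrow> complex"
      \<comment> \<open>A zero weight at index 0 turns \<open>Y\<close> into a sum over all
        coordinates, as the Chebyshev bound expects.\<close>
      define w where "w j = (if j = 0 then 0 else v j)" for j :: nat
      have b0: "cmod b \<ge> 1" "4 * B / (\<delta> * sqrt \<kappa>) \<le> cmod b" using b by (auto simp: K_def)
      have "cmod b > 0" using b0 by linarith
      then have r: "r > 0" using \<delta> by (simp add: r_def)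
      have split: "{..<Suc n} = insert 0 {1..<Suc n}" by auto
      have Yw: "Y \<omega> = (\<Sum>j<Suc n. w j * (s (\<omega> j) - \<mu>))" for \<omega>
        unfolding split Y_def by (simp add: w_def)
      have w: "(\<Sum>j<Suc n. (cmod (w j))\<^sup>2) \<le> 1"
        unfolding split using v[rule_format, of "Suc n"] by (simp add: w_def)
      have "measure_pmf.prob ?P {\<omega>. r \<le> cmod (Y \<omega>)} \<le> (2 * B / r)\<^sup>2"
        unfolding Yw \<mu>_def using s(1) by (intro chebyshev_Pi_pmf fin r w) (auto simp: T_def)
      also have "\<dots> \<le> (sqrt \<kappa>)\<^sup>2"
      proof (rule power_mono)
        obtain x where "x \<in> T" using T0 by (auto simp: card_gt_0_iff)
        then have "B \<ge> 0" using s(1) norm_ge_zero order_trans by blast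
        then show "0 \<le> 2 * B / r" using r by simp
        show "2 * B / r \<le> sqrt \<kappa>"
          using b0(2) \<open>cmod b > 0\<close> \<delta> \<kappa>(1) by (simp add: r_def field_simps)
      qed
      also have "\<dots> = \<kappa>" using \<kappa> by simp
      finally have "measure_pmf.prob ?P (- {\<omega>. cmod (Y \<omega>) < r}) \<le> \<kappa>"
        by (simp add: Compl_eq not_less)
      moreover have "\<omega> 0 = \<omega>' 0"
        if "cmod (Y \<omega>) < r" "cmod (Y \<omega>') < r" "digit_relation T \<eta> (Suc n) \<omega> \<omega>'" for \<omega> \<omega>'
      proof (rule ccontr)
        assume neq: "\<omega> 0 \<noteq> \<omega>' 0"
        have mem: "\<omega> 0 \<in> T" "\<omega>' 0 \<in> T" using that(3) by (auto simp: digit_relation_def)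
        have "Y \<omega> - Y \<omega>' = (\<Sum>j=1..<Suc n. v j * (s (\<omega> j) - s (\<omega>' j)))"
          unfolding Y_def sum_subtractf[symmetric] by (intro sum.cong) (auto simp: algebra_simps)
        then have "b * (s (\<omega> 0) - s (\<omega>' 0)) + (Y \<omega> - Y \<omega>') = 0"
          using rel that(3) by metis
        then have eq: "b * (s (\<omega> 0) - s (\<omega>' 0)) = Y \<omega>' - Y \<omega>"
          by (metis eq_neg_iff_add_eq_0 minus_diff_eq)
        have "cmod b * \<delta> \<le> cmod b * cmod (s (\<omega> 0) - s (\<omega>' 0))"
          using s(2) mem neq by (intro mult_left_mono) auto
        also have "\<dots> = cmod (Y \<omega>' - Y \<omega>)" by (simp add: norm_mult flip: eq)
        also have "\<dots> \<le> cmod (Y \<omega>') + cmod (Y \<omega>)" by (rule norm_triangle_ineq4)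
        finally show False using that by (simp add: r_def)
      qed
      ultimately show ?thesis by (intro exI[of _ "{\<omega>. cmod (Y \<omega>) < r}"]) auto
    qed
    then obtain D where D: "measure_pmf.prob ?P (- D) \<le> \<kappa>"
      "\<And>\<omega> \<omega>'. \<omega> \<in> D \<Longrightarrow> \<omega>' \<in> D \<Longrightarrow> digit_relation (set_pmf \<nu>) \<eta> (Suc n) \<omega> \<omega>' \<Longrightarrow> \<omega> 0 = \<omega>' 0"
      unfolding T_def by blast
    have "shannon_entropy (partial_sum_law \<eta> \<nu> n) + shannon_entropy \<nu> \<le>
            shannon_entropy (partial_sum_law \<eta> \<nu> (Suc n)) + c * card (set_pmf \<nu>) + \<kappa> * (1 - ln c)"
      by (rule shannon_entropy_partial_sum_law_Suc_ge[OF fin \<eta>(2) c(1,2) D(1)]) (rule D(2))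
    then show "shannon_entropy (partial_sum_law \<eta> \<nu> n) + h \<le> shannon_entropy (partial_sum_law \<eta> \<nu> (Suc n))"
      using c(3) \<kappa>(2) by (simp add: H\<nu> \<epsilon>_def L_def T_def)
  qed
  then show ?thesis
    \<comment> \<open>The maximum with \<open>1\<close> ensures positivity.\<close>
    unfolding \<nu>_def by (intro exI[of _ "max 1 M"]) auto
qed

end
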